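(* Let $\omega\in\mathcal S_V$ be full rank and satisfy $\mathrm{TC}(c)$ for some $c>0$. Then for every $O\in\mathcal O_V$ and $r\ge0$, $$\mathbb P_\omega\big(|O-\mathrm{Tr}(\omega O)\mathbb I|\ge r\big)\le2\exp\Big(-\frac{r^2}{4c\max\{\|(\omega^{-1/2}O\omega^{1/2})_R\|_L^2,\|(\omega^{-1/2}O\omega^{1/2})_I\|_L^2\}}\Big).$$ If moreover $[O,\omega]=0$, then $$\mathbb P_\omega\big(|O-\mathrm{Tr}(\omega O)\mathbb I|\ge r\big)\le2\exp\Big(-\frac{r^2}{c\|O\|_L^2}\Big).$$
   Context: $V$ finite, each site a qudit $\mathbb C^d$; $\mathcal O_V$ self-adjoint operators, $\mathcal S_V$ states. For an operator $X$, $X_R=(X+X^\dagger)/2$ and $X_I=(X-X^\dagger)/(2i)$. Quantum Lipschitz constant: $\|H\|_L:=2\max_{i\in V}\min\{\|H-H^{(i)}\|_\infty:H^{(i)}\in\mathcal O_V\text{ acts trivially on site }i\}$; quantum $W_1$ distance $\|\rho-\omega\|_{W_1}:=\max\{\mathrm{Tr}[(\rho-\omega)H]:H\in\mathcal O_V,\|H\|_L\le1\}$. $\omega$ satisfies $\mathrm{TC}(c)$ if $\|\rho-\omega\|_{W_1}\le\sqrt{c\,S(\rho\|\omega)}$ for all $\rho\in\mathcal S_V$, with $S(\rho\|\omega)=\mathrm{Tr}[\rho(\ln\rho-\ln\omega)]$. For $Q\in\mathcal O_V$ with spectral decomposition $Q=\sum_\lambda\lambda P_\lambda$, $\mathbb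 P_\omega(|Q|\ge r):=\sum_{|\lambda|\ge r}\mathrm{Tr}(\omega P_\lambda)$ (probability that measuring $Q$ on $\omega$ gives an eigenvalue of absolute value $\ge r$). *)

theory Defs
  imports Complex_Main
begin

text \<open>Finite set of sites V, each site a qudit C^d. The computational basis of the
 Hilbert space of V is indexed by configurations x :: 'v => nat with x v < d for v in V
 (and x v = 0 outside V). Operators are complex matrices indexed by configurations,
 represented as functions vanishing outside the configuration set.\<close>

type_synonym 'v qop = "('v \<Rightarrow> nat) \<Rightarrow> ('v \<Rightarrow> nat) \<Rightarrow> complex"
type_synonym 'v qvec = "('v \<Rightarrow> nat) \<Rightarrow> complex"

definition cfgs :: "'v set \<Rightarrow> nat \<Rightarrow> ('v \<Rightarrow> nat) set" where
  "cfgs V d = {x. (\<forall>v\<in>V. x v < d) \<and> (\<forall>v. v \<notin> V \<longrightarrow> x v = 0)}"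

definition is_op :: "'v set \<Rightarrow> nat \<Rightarrow> 'v qop \<Rightarrow> bool" where
  "is_op V d A \<longleftrightarrow> (\<forall>x y. x \<notin> cfgs V d \<or> y \<notin> cfgs V d \<longrightarrow> A x y = 0)"

definition is_vec :: "'v set \<Rightarrow> nat \<Rightarrow> 'v qvec \<Rightarrow> bool" where
  "is_vec V d v \<longleftrightarrow> (\<forall>x. x \<notin> cfgs V d \<longrightarrow> v x = 0)"

definition op_mult :: "'v set \<Rightarrow> nat \<Rightarrow> 'v qop \<Rightarrow> 'v qop \<Rightarrow> 'v qop" where
  "op_mult V d A B = (\<lambda>x y. \<Sum>z\<in>cfgs V d. A x z * B z y)"

definition op_adj :: "'v qop \<Rightarrow> 'v qop" where
  "op_adj A = (\<lambda>x y. cnj (A y x))"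

definition op_id :: "'v set \<Rightarrow> nat \<Rightarrow> 'v qop" where
  "op_id V d = (\<lambda>x y. if x = y \<and> x \<in> cfgs V d then 1 else 0)"

definition op_add :: "'v qop \<Rightarrow> 'v qop \<Rightarrow> 'v qop" where
  "op_add A B = (\<lambda>x y. A x y + B x y)"

definition op_diff :: "'v qop \<Rightarrow> 'v qop \<Rightarrow> 'v qop" where
  "op_diff A B = (\<lambda>x y. A x y - B x y)"

definition op_scale :: "complex \<Rightarrow> 'v qop \<Rightarrow> 'v qop" where
  "op_scale a A = (\<lambda>x y. a * A x y)"

definition op_apply :: "'v set \<Rightarrow> nat \<Rightarrow> 'v qop \<Rightarrow> 'v qvec \<Rightarrow> 'v qvec" where
  "op_apply V d A v = (\<lambda>x. \<Sum>y\<in>cfgs V d. A x y * v y)"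

definition vinner :: "'v set \<Rightarrow> nat \<Rightarrow> 'v qvec \<Rightarrow> 'v qvec \<Rightarrow> complex" where
  "vinner V d u v = (\<Sum>x\<in>cfgs V d. cnj (u x) * v x)"

definition vnorm :: "'v set \<Rightarrow> nat \<Rightarrow> 'v qvec \<Rightarrow> real" where
  "vnorm V d v = sqrt (\<Sum>x\<in>cfgs V d. (cmod (v x))\<^sup>2)"

definition op_norm :: "'v set \<Rightarrow> nat \<Rightarrow> 'v qop \<Rightarrow> real" where
  "op_norm V d A = Sup {vnorm V d (op_apply V d A v) | v. is_vec V d v \<and> vnorm V d v = 1}"

definition tr :: "'v set \<Rightarrow> nat \<Rightarrow> 'v qop \<Rightarrow> complex" where
  "tr V d A = (\<Sum>x\<in>cfgs V d. A x x)"

definition self_adjoint :: "'v set \<Rightarrow> nat \<Rightarrow> 'v qop \<Rightarrow> bool" where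
  "self_adjoint V d A \<longleftrightarrow> is_op V d A \<and> op_adj A = A"

definition psd :: "'v set \<Rightarrow> nat \<Rightarrow> 'v qop \<Rightarrow> bool" where
  "psd V d A \<longleftrightarrow> self_adjoint V d A \<and>
     (\<forall>v. is_vec V d v \<longrightarrow> 0 \<le> Re (vinner V d v (op_apply V d A v)))"

definition is_state :: "'v set \<Rightarrow> nat \<Rightarrow> 'v qop \<Rightarrow> bool" where
  "is_state V d \<rho> \<longleftrightarrow> psd V d \<rho> \<and> tr V d \<rho> = 1"

definition full_rank :: "'v set \<Rightarrow> nat \<Rightarrow> 'v qop \<Rightarrow> bool" where
  "full_rank V d A \<longleftrightarrow> (\<exists>B. is_op V d B \<and> op_mult V d A B = op_id V d)"

definition spectral_decomp ::
  "'v set \<Rightarrow> nat \<Rightarrow> 'v qop \<Rightarrow> (('v \<Rightarrow> nat) \<Rightarrow> 'v qvec) \<Rightarrow> (('v \<Rightarrow> nat) \<Rightarrow> real) \<Rightarrow> bool" where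
  "spectral_decomp V d A u lam \<longleftrightarrow>
     (\<forall>k\<in>cfgs V d. is_vec V d (u k)) \<and>
     (\<forall>k\<in>cfgs V d. \<forall>l\<in>cfgs V d. vinner V d (u k) (u l) = (if k = l then 1 else 0)) \<and>
     A = (\<lambda>x y. \<Sum>k\<in>cfgs V d. complex_of_real (lam k) * u k x * cnj (u k y))"

definition fcalc :: "'v set \<Rightarrow> nat \<Rightarrow> (real \<Rightarrow> real) \<Rightarrow> 'v qop \<Rightarrow> 'v qop" where
  "fcalc V d f A = (SOME B. \<exists>u lam. spectral_decomp V d A u lam \<and>
      B = (\<lambda>x y. \<Sum>k\<in>cfgs V d. complex_of_real (f (lam k)) * u k x * cnj (u k y)))"

definition spectrum_sa :: "'v set \<Rightarrow> nat \<Rightarrow> 'v qop \<Rightarrow> real set" where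
  "spectrum_sa V d A = {t. \<exists>v. is_vec V d v \<and> v \<noteq> (\<lambda>_. 0) \<and>
       op_apply V d A v = (\<lambda>x. complex_of_real t * v x)}"

definition spec_proj :: "'v set \<Rightarrow> nat \<Rightarrow> 'v qop \<Rightarrow> real \<Rightarrow> 'v qop" where
  "spec_proj V d A t = fcalc V d (\<lambda>s. if s = t then 1 else 0) A"

definition prob_abs_ge :: "'v set \<Rightarrow> nat \<Rightarrow> 'v qop \<Rightarrow> 'v qop \<Rightarrow> real \<Rightarrow> real" where
  "prob_abs_ge V d \<omega> Q r =
     (\<Sum>t\<in>{t\<in>spectrum_sa V d Q. r \<le> \<bar>t\<bar>}. Re (tr V d (op_mult V d \<omega> (spec_proj V d Q t))))"

text \<open>H acts trivially on site i, i.e. H = H' \<otimes> I_i (written out in the basis).\<close>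
definition acts_trivially :: "'v set \<Rightarrow> nat \<Rightarrow> 'v \<Rightarrow> 'v qop \<Rightarrow> bool" where
  "acts_trivially V d i H \<longleftrightarrow> (\<forall>x\<in>cfgs V d. \<forall>y\<in>cfgs V d.
      H x y = (if x i = y i then H (x(i := 0)) (y(i := 0)) else 0))"

text \<open>Quantum Lipschitz constant (max over the empty set of sites read as 0).\<close>
definition lip :: "'v set \<Rightarrow> nat \<Rightarrow> 'v qop \<Rightarrow> real" where
  "lip V d H = 2 * Max (insert 0 ((\<lambda>i. Inf {op_norm V d (op_diff H H') | H'.
       self_adjoint V d H' \<and> acts_trivially V d i H'}) ` V))"

definition W1 :: "'v set \<Rightarrow> nat \<Rightarrow> 'v qop \<Rightarrow> 'v qop \<Rightarrow> real" where
  "W1 V d \<rho> \<omega> = Sup {Re (tr V d (op_mult V d (op_diff \<rho> \<omega>) H)) | H.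
       self_adjoint V d H \<and> lip V d H \<le> 1}"

text \<open>Relative entropy; real ln satisfies ln 0 = 0, giving the convention 0 ln 0 = 0.\<close>
definition rel_ent :: "'v set \<Rightarrow> nat \<Rightarrow> 'v qop \<Rightarrow> 'v qop \<Rightarrow> real" where
  "rel_ent V d \<rho> \<omega> =
     Re (tr V d (op_mult V d \<rho> (op_diff (fcalc V d ln \<rho>) (fcalc V d ln \<omega>))))"

definition TC :: "'v set \<Rightarrow> nat \<Rightarrow> real \<Rightarrow> 'v qop \<Rightarrow> bool" where
  "TC V d c \<omega> \<longleftrightarrow> (\<forall>\<rho>. is_state V d \<rho> \<longrightarrow> W1 V d \<rho> \<omega> \<le> sqrt (c * rel_ent V d \<rho> \<omega>))"

definition op_re :: "'v qop \<Rightarrow> 'v qop" where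
  "op_re X = op_scale (1/2) (op_add X (op_adj X))"

definition op_im :: "'v qop \<Rightarrow> 'v qop" where
  "op_im X = op_scale (1/(2*\<i>)) (op_diff X (op_adj X))"

end

theory Submission
  imports Defs "HOL-Analysis.Analysis" "HOL-Real_Asymp.Real_Asymp"
begin

text \<open>The obstacle is that \<open>\<omega>\<close> and \<open>O\<close> need not commute. The
  Gibbs tilt \<open>exp (ln \<omega> + s O)\<close> has an explicit entropy, but by Golden-Thompson
  its partition function lies below the Laplace transform of the outcome distribution, which is the
  wrong direction for a tail bound. The trace of \<open>R exp(s O) R\<close> equals that Laplace
  transform exactly, by cyclicity. The price is twofold. The entropy of the sandwiched state is only
  bounded from above; this suffices, because it stands on the larger side of the transport
  inequality. And the observable with a classical mean is \<open>X\<close>: the identity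
  \<open>R X = O R\<close> brings \<open>O\<close> next to its own exponential under the trace.
  \<open>X\<close> need not be self-adjoint, but its mean is real, so its real part has the same
  mean and is an admissible test observable. The entropy bound is obtained without operator
  convexity: both entropies are integrals of resolvents over \<open>t\<close>, and the integrands
  are compared through a variational formula and Cauchy-Schwarz.\<close>

text \<open>Let \<open>O\<close> have eigenbasis \<open>e\<^sub>k\<close> with eigenvalues \<open>x\<^sub>k\<close> and put \<open>q\<^sub>k = \<langle>e\<^sub>k|\<omega>|e\<^sub>k\<rangle>\<close>. For real \<open>s\<close> let
  \<open>\<rho>\<close> be the normalisation of \<open>R exp(s O) R\<close> with \<open>R\<close> the square root of \<open>\<omega>\<close>. With
  \<open>X = R\<inverse> O R\<close>, the trace of \<open>\<rho> X\<close> is the mean of \<open>x\<close> under the classical tilt \<open>p\<^sub>k\<close>, proportional to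
  \<open>q\<^sub>k exp(s x\<^sub>k)\<close>, and \<open>S(\<rho>\<parallel>\<omega>)\<close> is at most the classical relative entropy of \<open>p\<close> and \<open>q\<close>
  (the Belavkin-Staszewski bound). Hence the Bobkov-Goetze argument applies to the outcome distribution
  \<open>q\<close>: the transport inequality tested on \<open>op_re X\<close> bounds its Laplace transform by a Gaussian one, and
  Chernoff's bound gives the tail \<open>2 exp(- r\<^sup>2 / (c L\<^sup>2))\<close> with \<open>L\<close> the Lipschitz constant of \<open>op_re X\<close>
  alone, which is stronger than the first claim. If \<open>O\<close> commutes with \<open>\<omega>\<close> then \<open>X = O\<close>.\<close>

subsection \<open>Matrix elements and diagonal operators\<close>

text \<open>\<open>brk V d u A v\<close> is the bra-ket \<open>\<langle>u|A|v\<rangle>\<close>.\<close>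

definition brk :: "'v set \<Rightarrow> nat \<Rightarrow> 'v qvec \<Rightarrow> 'v qop \<Rightarrow> 'v qvec \<Rightarrow> complex" where
  "brk V d u A v = vinner V d u (op_apply V d A v)"

text \<open>The basis vectors are labelled by the configurations themselves, so their number is the
  dimension and completeness can be derived (\<open>onb_complete\<close>) instead of being
  required.\<close>

definition onb :: "'v set \<Rightarrow> nat \<Rightarrow> (('v \<Rightarrow> nat) \<Rightarrow> 'v qvec) \<Rightarrow> bool" where
  "onb V d u \<longleftrightarrow> (\<forall>k\<in>cfgs V d. is_vec V d (u k)) \<and>
     (\<forall>k\<in>cfgs V d. \<forall>l\<in>cfgs V d. vinner V d (u k) (u l) = (if k = l then 1 else 0))"

definition diag_op ::
  "'v set \<Rightarrow> nat \<Rightarrow> (('v \<Rightarrow> nat) \<Rightarrow> 'v qvec) \<Rightarrow> (('v \<Rightarrow> nat) \<Rightarrow> real) \<Rightarrow> 'v qop" where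
  "diag_op V d u f = (\<lambda>x y. \<Sum>k\<in>cfgs V d. complex_of_real (f k) * u k x * cnj (u k y))"

lemma spectral_decomp_iff: "spectral_decomp V d A u lam \<longleftrightarrow> onb V d u \<and> A = diag_op V d u lam"
  by (auto simp: spectral_decomp_def onb_def diag_op_def)

lemma finite_cfgs:
  assumes "finite V"
  shows "finite (cfgs V d)"
proof -
  have "x \<in> (\<lambda>f v. if v \<in> V then f v else 0) ` (V \<rightarrow>\<^sub>E {..<d})" if "x \<in> cfgs V d" for x
  proof (rule image_eqI[where x = "restrict x V"])
    show "x = (\<lambda>v. if v \<in> V then restrict x V v else 0)"
      using that by (auto simp: cfgs_def fun_eq_iff)
    show "restrict x V \<in> V \<rightarrow>\<^sub>E {..<d}"
      using that by (auto simp: cfgs_def)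
  qed
  then have "cfgs V d \<subseteq> (\<lambda>f v. if v \<in> V then f v else 0) ` (V \<rightarrow>\<^sub>E {..<d})" by blast
  moreover have "finite (V \<rightarrow>\<^sub>E {..<d})" by (intro finite_PiE assms) auto
  ultimately show ?thesis by (meson finite_imageI finite_subset)
qed

lemma op_mult_assoc: "op_mult V d (op_mult V d A B) C = op_mult V d A (op_mult V d B C)"
  unfolding op_mult_def
  by (intro ext) (simp add: sum_distrib_left sum_distrib_right mult.assoc, rule sum.swap)

lemma tr_mult_commute: "tr V d (op_mult V d A B) = tr V d (op_mult V d B A)"
  unfolding tr_def op_mult_def by (subst sum.swap) (simp add: mult.commute)

lemma is_op_mult: "is_op V d A \<Longrightarrow> is_op V d B \<Longrightarrow> is_op V d (op_mult V d A B)"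
  by (auto simp: is_op_def op_mult_def)

lemma is_op_id: "is_op V d (op_id V d)"
  by (auto simp: is_op_def op_id_def)

lemma op_adj_mult: "op_adj (op_mult V d A B) = op_mult V d (op_adj B) (op_adj A)"
  by (auto simp: op_adj_def op_mult_def mult.commute)

lemma tr_op_diff: "tr V d (op_diff A B) = tr V d A - tr V d B"
  by (simp add: tr_def op_diff_def sum_subtractf)

lemma tr_op_add: "tr V d (op_add A B) = tr V d A + tr V d B"
  by (simp add: tr_def op_add_def sum.distrib)

lemma tr_op_scale: "tr V d (op_scale a A) = a * tr V d A"
  by (simp add: tr_def op_scale_def sum_distrib_left)

lemma tr_op_adj: "tr V d (op_adj A) = cnj (tr V d A)"
  by (simp add: tr_def op_adj_def)

lemma op_mult_diff_left: "op_mult V d (op_diff A B) C = op_diff (op_mult V d A C) (op_mult V d B C)"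
  by (auto simp: op_mult_def op_diff_def sum_subtractf left_diff_distrib)

lemma op_mult_diff_right: "op_mult V d A (op_diff B C) = op_diff (op_mult V d A B) (op_mult V d A C)"
  by (auto simp: op_mult_def op_diff_def sum_subtractf right_diff_distrib)

lemma op_mult_add_right: "op_mult V d A (op_add B C) = op_add (op_mult V d A B) (op_mult V d A C)"
  by (auto simp: op_mult_def op_add_def sum.distrib distrib_left)

lemma op_mult_scale_right: "op_mult V d A (op_scale a B) = op_scale a (op_mult V d A B)"
  by (auto simp: op_mult_def op_scale_def sum_distrib_left mult_ac)

lemma vinner_cnj: "cnj (vinner V d u v) = vinner V d v u"
  by (simp add: vinner_def mult.commute)

lemma vinner_self: "vinner V d u u = complex_of_real (\<Sum>x\<in>cfgs V d. (cmod (u x))\<^sup>2)"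
  unfolding vinner_def of_real_sum
  by (rule sum.cong[OF refl], subst mult.commute, subst complex_norm_square) simp

lemma brk_eq_sum: "brk V d u A v = (\<Sum>x\<in>cfgs V d. \<Sum>y\<in>cfgs V d. cnj (u x) * A x y * v y)"
  by (simp add: brk_def vinner_def op_apply_def sum_distrib_left mult.assoc)

lemma cnj_brk: "cnj (brk V d u A v) = brk V d v (op_adj A) u"
  unfolding brk_eq_sum op_adj_def cnj_sum
  by (subst sum.swap) (simp add: mult_ac)

lemma is_op_diag: "onb V d u \<Longrightarrow> is_op V d (diag_op V d u f)"
  by (auto simp: is_op_def diag_op_def onb_def is_vec_def)

lemma op_adj_diag: "op_adj (diag_op V d u f) = diag_op V d u f"
  by (auto simp: op_adj_def diag_op_def mult_ac)

lemma self_adjoint_diag: "onb V d u \<Longrightarrow> self_adjoint V d (diag_op V d u f)"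
  by (simp add: self_adjoint_def is_op_diag op_adj_diag)

lemma tr_mult_diag:
  "tr V d (op_mult V d A (diag_op V d u f)) = (\<Sum>k\<in>cfgs V d. f k * brk V d (u k) A (u k))"
proof -
  have "tr V d (op_mult V d A (diag_op V d u f)) =
      (\<Sum>x\<in>cfgs V d. \<Sum>y\<in>cfgs V d. \<Sum>k\<in>cfgs V d. f k * (cnj (u k x) * A x y * u k y))"
    by (simp add: tr_def op_mult_def diag_op_def sum_distrib_left mult_ac)
  also have "\<dots> = (\<Sum>k\<in>cfgs V d. \<Sum>x\<in>cfgs V d. \<Sum>y\<in>cfgs V d. f k * (cnj (u k x) * A x y * u k y))"
    by (subst (2) sum.swap, subst sum.swap) simp
  finally show ?thesis by (simp add: brk_eq_sum sum_distrib_left)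
qed

lemma vinner_diff_right: "vinner V d u (\<lambda>x. v x - w x) = vinner V d u v - vinner V d u w"
  by (simp add: vinner_def right_diff_distrib sum_subtractf)

lemma vinner_scale_right: "vinner V d u (\<lambda>x. a * v x) = a * vinner V d u v"
  by (simp add: vinner_def sum_distrib_left mult_ac)

lemma vinner_sum_right: "vinner V d u (\<lambda>x. \<Sum>k\<in>K. f k x) = (\<Sum>k\<in>K. vinner V d u (f k))"
  by (simp add: vinner_def sum_distrib_left) (rule sum.swap)

lemma op_apply_mult: "op_apply V d (op_mult V d A B) v = op_apply V d A (op_apply V d B v)"
  unfolding op_apply_def op_mult_def
  by (intro ext) (simp add: sum_distrib_left sum_distrib_right mult.assoc, rule sum.swap)

lemma op_apply_diag:
  "op_apply V d (diag_op V d e f) v = (\<lambda>x. \<Sum>k\<in>cfgs V d. f k * vinner V d (e k) v * e k x)"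
  unfolding op_apply_def diag_op_def vinner_def
  by (intro ext) (simp add: sum_distrib_left sum_distrib_right mult_ac, rule sum.swap)

lemma brk_sum_right:
  "vinner V d u (op_apply V d A (\<lambda>x. \<Sum>k\<in>K. c k * e k x)) = (\<Sum>k\<in>K. c k * brk V d u A (e k))"
proof -
  have "op_apply V d A (\<lambda>x. \<Sum>k\<in>K. c k * e k x) = (\<lambda>x. \<Sum>k\<in>K. c k * op_apply V d A (e k) x)"
    unfolding op_apply_def
    by (intro ext) (simp add: sum_distrib_left mult_ac, rule sum.swap)
  then show ?thesis
    by (simp only: vinner_sum_right vinner_scale_right brk_def)
qed

lemma brk_mult_diag_mult:
  "brk V d u (op_mult V d A (op_mult V d (diag_op V d e f) B)) v =
     (\<Sum>k\<in>cfgs V d. f k * brk V d u A (e k) * brk V d (e k) B v)"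
  by (simp add: brk_def[of V d u "op_mult V d A (op_mult V d (diag_op V d e f) B)"]
      op_apply_mult op_apply_diag brk_sum_right brk_def[of V d "e _" B v])
    (simp add: mult_ac)

lemma brk_diag:
  "brk V d u (diag_op V d e f) v = (\<Sum>k\<in>cfgs V d. f k * vinner V d u (e k) * vinner V d (e k) v)"
  by (simp add: brk_def op_apply_diag vinner_sum_right vinner_scale_right) (simp add: mult_ac)

subsection \<open>Orthonormal bases and functional calculus\<close>

lemma Re_vinner_self: "Re (vinner V d u u) = (\<Sum>x\<in>cfgs V d. (cmod (u x))\<^sup>2)"
  by (simp add: vinner_self)

lemma vinner_self_eq_0:
  assumes "finite V" "is_vec V d u" "vinner V d u u = 0"
  shows "u = (\<lambda>_. 0)"
proof -
  have "(\<Sum>x\<in>cfgs V d. (cmod (u x))\<^sup>2) = 0"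
    using assms(3) Re_vinner_self[of V d u] by simp
  then have "\<forall>x\<in>cfgs V d. u x = 0"
    using finite_cfgs[OF assms(1)] by (simp add: sum_nonneg_eq_0_iff)
  then show ?thesis using assms(2) by (auto simp: is_vec_def fun_eq_iff)
qed

text \<open>\<open>r\<close> is the Gram-Schmidt residual of the standard basis vector at
  \<open>x\<close>. It is orthogonal to every \<open>u k\<close>, so pairing it with itself leaves
  only its pairing with that basis vector, which is \<open>cnj (r x)\<close>.\<close>

lemma bessel_unit:
  assumes fin: "finite V" and K: "K \<subseteq> cfgs V d" and x: "x \<in> cfgs V d"
    and orth: "\<forall>k\<in>K. \<forall>l\<in>K. vinner V d (u k) (u l) = (if k = l then 1 else 0)"
    and r: "r = (\<lambda>y. (if y = x then 1 else 0) - (\<Sum>k\<in>K. cnj (u k x) * u k y))"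
  shows "vinner V d r r = 1 - complex_of_real (\<Sum>k\<in>K. (cmod (u k x))\<^sup>2)"
    and "k \<in> K \<Longrightarrow> vinner V d (u k) r = 0"
proof -
  have finI: "finite (cfgs V d)" by (rule finite_cfgs[OF fin])
  have finK: "finite K" using K finI finite_subset by blast
  have delta: "vinner V d v (\<lambda>y. if y = x then 1 else 0) = cnj (v x)" for v
    unfolding vinner_def using x finI by (simp add: if_distrib cong: if_cong)
  have right: "vinner V d v r = cnj (v x) - (\<Sum>k\<in>K. cnj (u k x) * vinner V d v (u k))" for v
    unfolding r by (simp add: vinner_diff_right vinner_sum_right vinner_scale_right delta)
  show *: "vinner V d (u k) r = 0" if k: "k \<in> K" for k
  proof -
    have "(\<Sum>l\<in>K. cnj (u l x) * vinner V d (u k) (u l)) = (\<Sum>l\<in>K. if l = k then cnj (u l x) else 0)"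
      using k by (intro sum.cong) (auto simp: orth)
    then show ?thesis using k finK by (simp add: right)
  qed
  have "vinner V d r (u k) = 0" if "k \<in> K" for k
    using *[OF that] by (metis vinner_cnj complex_cnj_zero)
  then have "vinner V d r r = cnj (r x)"
    by (simp add: right)
  also have "\<dots> = 1 - (\<Sum>k\<in>K. u k x * cnj (u k x))"
    by (simp add: r)
  finally show "vinner V d r r = 1 - complex_of_real (\<Sum>k\<in>K. (cmod (u k x))\<^sup>2)"
    by (simp add: complex_norm_square del: of_real_power)
qed

lemma sum_norm_orthonormal:
  assumes fin: "finite V" and K: "K \<subseteq> cfgs V d"
    and orth: "\<forall>k\<in>K. \<forall>l\<in>K. vinner V d (u k) (u l) = (if k = l then 1 else 0)"
  shows "(\<Sum>x\<in>cfgs V d. \<Sum>k\<in>K. (cmod (u k x))\<^sup>2) = card K"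
proof -
  have "(\<Sum>x\<in>cfgs V d. \<Sum>k\<in>K. (cmod (u k x))\<^sup>2) = (\<Sum>k\<in>K. Re (vinner V d (u k) (u k)))"
    by (subst sum.swap) (simp add: Re_vinner_self)
  also have "\<dots> = card K" using orth by simp
  finally show ?thesis .
qed

text \<open>Dimension count: the squared entries of the \<open>u k\<close> add up to
  \<open>card K\<close>, which is less than the number of configurations, so at some
  \<open>x\<close> they add up to less than 1. The residual of the basis vector at that
  \<open>x\<close> is nonzero and can be normalised.\<close>

lemma exists_orthogonal:
  assumes fin: "finite V" and K: "K \<subset> cfgs V d"
    and orth: "\<forall>k\<in>K. \<forall>l\<in>K. vinner V d (u k) (u l) = (if k = l then 1 else 0)"
    and vec: "\<forall>k\<in>K. is_vec V d (u k)"
  shows "\<exists>v. is_vec V d v \<and> vinner V d v v = 1 \<and> (\<forall>k\<in>K. vinner V d (u k) v = 0)"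
proof -
  have finI: "finite (cfgs V d)" by (rule finite_cfgs[OF fin])
  have Ks: "K \<subseteq> cfgs V d" using K by blast
  have "card K < card (cfgs V d)" by (rule psubset_card_mono[OF finI K])
  then have "\<not> (\<forall>x\<in>cfgs V d. 1 \<le> (\<Sum>k\<in>K. (cmod (u k x))\<^sup>2))"
    using sum_norm_orthonormal[OF fin Ks orth]
      sum_bounded_below[of "cfgs V d" 1 "\<lambda>x. \<Sum>k\<in>K. (cmod (u k x))\<^sup>2"] by fastforce
  then obtain x where x: "x \<in> cfgs V d" "(\<Sum>k\<in>K. (cmod (u k x))\<^sup>2) < 1" by force
  define r where "r = (\<lambda>y. (if y = x then 1 else 0) - (\<Sum>k\<in>K. cnj (u k x) * u k y))"
  define s where "s = 1 - (\<Sum>k\<in>K. (cmod (u k x))\<^sup>2)"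
  note b = bessel_unit[OF fin Ks x(1) orth r_def]
  have s: "s > 0" "vinner V d r r = complex_of_real s"
    using x(2) b(1) by (auto simp: s_def)
  have r: "is_vec V d r" unfolding r_def is_vec_def using x(1) vec 
    by (auto simp: is_vec_def intro!: sum.neutral)
  define v where "v = (\<lambda>y. complex_of_real (1 / sqrt s) * r y)"
  have "is_vec V d v" using r by (simp add: is_vec_def v_def)
  moreover have "vinner V d v v = 1"
  proof -
    have "vinner V d v v = complex_of_real (1 / sqrt s) * complex_of_real (1 / sqrt s) * vinner V d r r"
      by (simp add: v_def vinner_def sum_distrib_left mult_ac)
    also have "\<dots> = complex_of_real ((1 / sqrt s) * (1 / sqrt s) * s)" by (simp only: s of_real_mult)
    also have "(1 / sqrt s) * (1 / sqrt s) * s = 1" using s(1) by simp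
    finally show ?thesis by simp
  qed
  moreover have "vinner V d (u k) v = 0" if "k \<in> K" for k
    unfolding v_def vinner_scale_right b(2)[OF that] by simp
  ultimately show ?thesis by blast
qed

text \<open>The squared norms \<open>s x\<close> of the residuals are nonnegative and sum to the
  dimension minus the number of basis vectors, that is to 0. Hence every residual vanishes, which is
  the resolution of the identity.\<close>

lemma onb_complete:
  assumes fin: "finite V" and u: "onb V d u"
  shows "diag_op V d u (\<lambda>_. 1) = op_id V d"
proof (intro ext)
  fix y x
  have finI: "finite (cfgs V d)" by (rule finite_cfgs[OF fin])
  have orth: "\<forall>k\<in>cfgs V d. \<forall>l\<in>cfgs V d. vinner V d (u k) (u l) = (if k = l then 1 else 0)"
    using u by (auto simp: onb_def)
  define R where "R x = (\<lambda>y. (if y = x then 1 else 0) - (\<Sum>k\<in>cfgs V d. cnj (u k x) * u k y))" for x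
  define s where "s x = 1 - (\<Sum>k\<in>cfgs V d. (cmod (u k x))\<^sup>2)" for x
  have Rs: "vinner V d (R x) (R x) = complex_of_real (s x)" if "x \<in> cfgs V d" for x
    using bessel_unit(1)[OF fin subset_refl that orth R_def] by (simp add: s_def)
  have "s x \<ge> 0" if "x \<in> cfgs V d" for x
    using Rs[OF that] Re_vinner_self[of V d "R x"] sum_nonneg[of "cfgs V d" "\<lambda>y. (cmod (R x y))\<^sup>2"] by simp
  moreover have "(\<Sum>x\<in>cfgs V d. s x) = 0"
    using sum_norm_orthonormal[OF fin subset_refl orth]
    by (simp add: s_def sum_subtractf)
  ultimately have s0: "s x = 0" if "x \<in> cfgs V d" for x
    using finI that by (simp add: sum_nonneg_eq_0_iff)
  show "diag_op V d u (\<lambda>_. 1) y x = op_id V d y x"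
  proof (cases "x \<in> cfgs V d \<and> y \<in> cfgs V d")
    case True
    have "is_vec V d (R x)" using True u unfolding R_def is_vec_def
      by (auto simp: onb_def is_vec_def intro!: sum.neutral)
    then have "R x = (\<lambda>_. 0)" using Rs s0 True vinner_self_eq_0[OF fin] by (metis of_real_0)
    then have "R x y = 0" by simp
    then show ?thesis using True by (auto simp: R_def diag_op_def op_id_def mult_ac split: if_splits)
  next
    case False
    then show ?thesis using is_op_diag[OF u] is_op_id unfolding is_op_def by metis
  qed
qed

lemma is_op_mult_id: 
  assumes "finite V" "is_op V d A" 
  shows "op_mult V d (op_id V d) A = A" "op_mult V d A (op_id V d) = A"
proof -
  have finI: "finite (cfgs V d)" by (rule finite_cfgs[OF assms(1)])
  show "op_mult V d (op_id V d) A = A"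
  proof (intro ext)
    fix x y
    have "op_mult V d (op_id V d) A x y = (\<Sum>z\<in>cfgs V d. if z = x then A z y else 0)"
      unfolding op_mult_def op_id_def by (intro sum.cong) auto
    then show "op_mult V d (op_id V d) A x y = A x y" using finI assms(2) by (auto simp: is_op_def)
  qed
  show "op_mult V d A (op_id V d) = A"
  proof (intro ext)
    fix x y
    have "op_mult V d A (op_id V d) x y = (\<Sum>z\<in>cfgs V d. if z = y then A x z else 0)"
      unfolding op_mult_def op_id_def by (intro sum.cong) auto
    then show "op_mult V d A (op_id V d) x y = A x y" using finI assms(2) by (auto simp: is_op_def)
  qed
qed

lemma brk_mult_onb:
  assumes "finite V" "onb V d e" "is_op V d B"
  shows "brk V d u (op_mult V d A B) v = (\<Sum>k\<in>cfgs V d. brk V d u A (e k) * brk V d (e k) B v)"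
  using brk_mult_diag_mult[of V d u A e "\<lambda>_. 1" B v]
  by (simp add: onb_complete[OF assms(1,2)] is_op_mult_id[OF assms(1,3)])

lemma diag_entry_mult:
  "op_mult V d (diag_op V d e (\<lambda>_. 1)) (op_mult V d A (diag_op V d e' (\<lambda>_. 1))) x y =
    (\<Sum>k\<in>cfgs V d. \<Sum>l\<in>cfgs V d. e k x * brk V d (e k) A (e' l) * cnj (e' l y))"
proof -
  have "op_mult V d A (diag_op V d e' (\<lambda>_. 1)) z y = (\<Sum>l\<in>cfgs V d. op_apply V d A (e' l) z * cnj (e' l y))" for z
    unfolding op_mult_def diag_op_def op_apply_def
    by (simp add: sum_distrib_left sum_distrib_right mult_ac) (rule sum.swap)
  then have "op_mult V d (diag_op V d e (\<lambda>_. 1)) (op_mult V d A (diag_op V d e' (\<lambda>_. 1))) x y =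
     (\<Sum>z\<in>cfgs V d. (\<Sum>k\<in>cfgs V d. e k x * cnj (e k z)) * (\<Sum>l\<in>cfgs V d. op_apply V d A (e' l) z * cnj (e' l y)))"
    by (simp add: op_mult_def[of V d "diag_op V d e (\<lambda>_. 1)"]) (simp add: diag_op_def)
  also have "\<dots> = (\<Sum>z\<in>cfgs V d. \<Sum>k\<in>cfgs V d. \<Sum>l\<in>cfgs V d. e k x * (cnj (e k z) * op_apply V d A (e' l) z) * cnj (e' l y))"
    by (simp add: sum_product mult_ac)
  also have "\<dots> = (\<Sum>k\<in>cfgs V d. \<Sum>l\<in>cfgs V d. \<Sum>z\<in>cfgs V d. e k x * (cnj (e k z) * op_apply V d A (e' l) z) * cnj (e' l y))"
    by (subst sum.swap) (rule sum.cong[OF refl], rule sum.swap)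
  finally show ?thesis
    by (simp add: brk_def vinner_def sum_distrib_left sum_distrib_right)
qed

text \<open>Two different bases are allowed on the two sides, so that operators diagonal in
  different eigenbases can be compared entrywise.\<close>

lemma op_eqI_onb:
  assumes fin: "finite V" and "onb V d e" "onb V d e'" and A: "is_op V d A" and B: "is_op V d B"
    and eq: "\<And>k l. k \<in> cfgs V d \<Longrightarrow> l \<in> cfgs V d \<Longrightarrow> brk V d (e k) A (e' l) = brk V d (e k) B (e' l)"
  shows "A = B"
proof -
  have "X = op_mult V d (diag_op V d e (\<lambda>_. 1)) (op_mult V d X (diag_op V d e' (\<lambda>_. 1)))" if "is_op V d X" for X
    using assms(2,3) that by (simp add: onb_complete[OF fin] is_op_mult_id[OF fin])
  note r = this[OF A] this[OF B]
  show ?thesis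
    by (subst r(1), subst r(2)) (simp add: fun_eq_iff diag_entry_mult eq)
qed

lemma op_apply_diag_onb:
  assumes "finite V" "onb V d e" "l \<in> cfgs V d"
  shows "op_apply V d (diag_op V d e f) (e l) = (\<lambda>x. f l * e l x)"
proof
  fix x
  have "(\<Sum>k\<in>cfgs V d. f k * vinner V d (e k) (e l) * e k x) = (\<Sum>k\<in>cfgs V d. if k = l then f k * e k x else 0)"
    using assms by (intro sum.cong) (auto simp: onb_def)
  then show "op_apply V d (diag_op V d e f) (e l) x = f l * e l x"
    using assms finite_cfgs[OF assms(1)] by (simp add: op_apply_diag)
qed

lemma brk_diag_right:
  assumes "finite V" "onb V d e" "l \<in> cfgs V d"
  shows "brk V d u (op_mult V d A (diag_op V d e f)) (e l) = f l * brk V d u A (e l)"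
  using brk_sum_right[of V d u A "\<lambda>_. f l" "\<lambda>_. e l" "{l}"]
  by (simp add: brk_def op_apply_mult op_apply_diag_onb[OF assms])

lemma brk_diag_left:
  assumes "finite V" "onb V d e" "l \<in> cfgs V d"
  shows "brk V d (e l) (op_mult V d (diag_op V d e f) A) v = f l * brk V d (e l) A v"
proof -
  have "cnj (brk V d v (op_mult V d (op_adj A) (diag_op V d e f)) (e l)) = f l * cnj (brk V d v (op_adj A) (e l))"
    by (simp add: brk_diag_right[OF assms])
  then show ?thesis 
    by (simp add: cnj_brk op_adj_mult op_adj_diag) (simp add: op_adj_def)
qed

lemma brk_id:
  assumes "finite V" "is_vec V d v"
  shows "brk V d u (op_id V d) v = vinner V d u v"
proof -
  have "op_apply V d (op_id V d) v x = v x" for x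
  proof -
    have "op_apply V d (op_id V d) v x = (\<Sum>y\<in>cfgs V d. if y = x then v y else 0)"
      unfolding op_apply_def op_id_def by (intro sum.cong) auto
    then show ?thesis using assms finite_cfgs[OF assms(1)] by (auto simp: is_vec_def)
  qed
  then show ?thesis by (simp add: brk_def vinner_def)
qed

lemma brk_diag_onb_right:
  assumes "finite V" "onb V d e" "l \<in> cfgs V d"
  shows "brk V d u (diag_op V d e f) (e l) = f l * vinner V d u (e l)"
  using brk_diag_right[OF assms, of u "op_id V d" f] assms
  by (simp add: is_op_mult_id is_op_diag brk_id onb_def)

lemma brk_diag_onb_left:
  assumes "finite V" "onb V d e" "l \<in> cfgs V d" "is_vec V d v"
  shows "brk V d (e l) (diag_op V d e f) v = f l * vinner V d (e l) v"
  using brk_diag_left[OF assms(1-3), of f "op_id V d" v] assms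
  by (simp add: is_op_mult_id is_op_diag brk_id)

lemma diag_mult_diag:
  assumes fin: "finite V" and e: "onb V d e"
  shows "op_mult V d (diag_op V d e f) (diag_op V d e g) = diag_op V d e (\<lambda>k. f k * g k)"
proof (rule op_eqI_onb[OF fin e e])
  fix k l assume k: "k \<in> cfgs V d" and l: "l \<in> cfgs V d"
  then have "vinner V d (e k) (e l) = (if k = l then 1 else 0)" using e by (simp add: onb_def)
  then show "brk V d (e k) (op_mult V d (diag_op V d e f) (diag_op V d e g)) (e l) =
      brk V d (e k) (diag_op V d e (\<lambda>k. f k * g k)) (e l)"
    by (simp add: brk_diag_left[OF fin e k] brk_diag_onb_right[OF fin e l])
qed (simp_all add: e is_op_mult is_op_diag)

lemma parseval:
  assumes "finite V" "onb V d e" "is_vec V d v" 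
  shows "(\<Sum>k\<in>cfgs V d. vinner V d u (e k) * vinner V d (e k) v) = vinner V d u v"
  using brk_diag[of V d u e "\<lambda>_. 1" v] assms by (simp add: onb_complete brk_id)

lemma parseval_norm:
  assumes "finite V" "onb V d e" "is_vec V d v" 
  shows "(\<Sum>k\<in>cfgs V d. (cmod (vinner V d (e k) v))\<^sup>2) = Re (vinner V d v v)"
proof -
  have "vinner V d v v = (\<Sum>k\<in>cfgs V d. complex_of_real ((cmod (vinner V d (e k) v))\<^sup>2))"
    unfolding parseval[OF assms, of v, symmetric]
    by (intro sum.cong refl, subst complex_norm_square) (simp add: vinner_cnj mult.commute)
  then show ?thesis by simp
qed

text \<open>Taking \<open>\<langle>u k| . |w l\<rangle>\<close> of the equation gives
  \<open>a k = b l\<close> wherever the overlap is nonzero, so \<open>f\<close> may be applied on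
  both sides. Degenerate eigenvalues need no separate treatment, and the choice operator in
  \<open>fcalc\<close> becomes harmless.\<close>

lemma fcalc_unique:
  assumes fin: "finite V" and u: "onb V d u" and w: "onb V d w"
    and eq: "diag_op V d u a = diag_op V d w b"
  shows "diag_op V d u (\<lambda>k. f (a k)) = diag_op V d w (\<lambda>k. f (b k))"
proof (rule op_eqI_onb[OF fin u w])
  fix k l assume k: "k \<in> cfgs V d" and l: "l \<in> cfgs V d"
  have wl: "is_vec V d (w l)" using w l by (simp add: onb_def)
  have "a k * vinner V d (u k) (w l) = b l * vinner V d (u k) (w l)"
    using brk_diag_onb_left[OF fin u k wl, of a] brk_diag_onb_right[OF fin w l, of "u k" b] eq by metis
  then have "vinner V d (u k) (w l) = 0 \<or> a k = b l"
    by (metis mult_cancel_right of_real_eq_iff)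
  then show "brk V d (u k) (diag_op V d u (\<lambda>k. f (a k))) (w l) = brk V d (u k) (diag_op V d w (\<lambda>k. f (b k))) (w l)"
    by (auto simp: brk_diag_onb_left[OF fin u k wl] brk_diag_onb_right[OF fin w l])
qed (use u w is_op_diag in auto)

lemma fcalc_diag:
  assumes fin: "finite V" and u: "onb V d u"
  shows "fcalc V d f (diag_op V d u a) = diag_op V d u (\<lambda>k. f (a k))"
  unfolding fcalc_def
proof (rule some_equality)
  show "\<exists>w b. spectral_decomp V d (diag_op V d u a) w b \<and>
     diag_op V d u (\<lambda>k. f (a k)) = (\<lambda>x y. \<Sum>k\<in>cfgs V d. complex_of_real (f (b k)) * w k x * cnj (w k y))"
    using u by (intro exI[of _ u] exI[of _ a]) (simp add: spectral_decomp_iff, simp add: diag_op_def)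
  show "B = diag_op V d u (\<lambda>k. f (a k))"
    if "\<exists>w b. spectral_decomp V d (diag_op V d u a) w b \<and>
      B = (\<lambda>x y. \<Sum>k\<in>cfgs V d. complex_of_real (f (b k)) * w k x * cnj (w k y))" for B
    using that fcalc_unique[OF fin u] unfolding spectral_decomp_iff by (auto simp: diag_op_def)
qed

subsection \<open>The spectral theorem\<close>

lemma vinner_self_adjoint:
  assumes "self_adjoint V d A"
  shows "vinner V d u (op_apply V d A v) = cnj (vinner V d v (op_apply V d A u))"
  using assms cnj_brk[of V d v A u] by (simp add: self_adjoint_def brk_def)

text \<open>First-order optimality condition for the variational proof of the spectral
  theorem.\<close>

lemma quadratic_nonneg_imp_linear_coeff_zero:
  fixes a b :: real
  assumes "\<And>s. 0 \<le> 2 * s * a + s\<^sup>2 * b"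
  shows "a = 0"
proof (rule ccontr)
  assume a: "a \<noteq> 0"
  \<comment> \<open>Any positive \<open>m\<close> with \<open>b < 2 * m\<close> works: at
    \<open>s = - a / m\<close> the expression is \<open>a\<^sup>2 / m\<^sup>2\<close> times
    \<open>b - 2 * m\<close>.\<close>
  define m where "m = \<bar>b\<bar> + 1"
  have m: "m > 0" "b < 2 * m" by (auto simp: m_def)
  have "2 * (- a / m) * a + (- a / m)\<^sup>2 * b = (a\<^sup>2 / m\<^sup>2) * (b - 2 * m)"
    using m(1) by (simp add: field_simps power2_eq_square)
  also have "\<dots> < 0"
    using a m by (intro mult_pos_neg) auto
  finally show False using assms[of "- a / m"] by linarith
qed

text \<open>Vectors are functions on an infinite type of configurations and carry the product
  topology. Compactness comes from Tychonoff: coordinates range over the unit disc on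
  \<open>cfgs V d\<close> and over \<open>{0}\<close> elsewhere, and the remaining conditions are
  closed.\<close>

lemma compact_unit_vectors:
  assumes fin: "finite V"
  shows "compact {v :: 'v qvec. is_vec V d v \<and> vinner V d v v = 1 \<and> (\<forall>k\<in>K. vinner V d (u k) v = 0)}"
proof -
  define P :: "'v qvec set" where "P = {v. \<forall>x. v x \<in> (if x \<in> cfgs V d then cball 0 1 else {0})}"
  have "P = (\<Pi>\<^sub>E x\<in>UNIV. if x \<in> cfgs V d then cball 0 1 else {0})"
    by (auto simp: P_def PiE_def Pi_def)
  moreover have "compact \<dots>"
    using compactin_PiE[of "\<lambda>_. euclidean" UNIV "\<lambda>x. if x \<in> cfgs V d then cball (0::complex) 1 else {0}"]
    by (simp add: euclidean_product_topology compactin_euclidean_iff)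
  ultimately have P: "compact P" by simp
  define C where "C = {v :: 'v qvec. vinner V d v v = 1} \<inter> (\<Inter>k\<in>K. {v. vinner V d (u k) v = 0})"
  have cont_vinner: "continuous_on UNIV (\<lambda>v :: 'v qvec. vinner V d (u k) v)" for k
    unfolding vinner_def
    by (intro continuous_on_sum continuous_on_mult continuous_on_const continuous_on_product_coordinates)
  have cont_self: "continuous_on UNIV (\<lambda>v :: 'v qvec. vinner V d v v)"
    unfolding vinner_def
    by (intro continuous_on_sum continuous_on_mult continuous_on_cnj continuous_on_product_coordinates)
  have "closed C"
    unfolding C_def
    by (intro closed_Int closed_INT ballI closed_Collect_eq continuous_on_const cont_vinner
        cont_self)
  then have "compact (P \<inter> C)" by (rule compact_Int_closed[OF P])
  moreover have "{v. is_vec V d v \<and> vinner V d v v = 1 \<and> (\<forall>k\<in>K. vinner V d (u k) v = 0)} = P \<inter> C"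
  proof -
    have "v \<in> P" if v: "is_vec V d v" "vinner V d v v = 1" for v
    proof -
      have "cmod (v x) \<le> 1" if x: "x \<in> cfgs V d" for x
      proof -
        have "(cmod (v x))\<^sup>2 \<le> (\<Sum>x\<in>cfgs V d. (cmod (v x))\<^sup>2)"
          using finite_cfgs[OF fin] x by (intro member_le_sum) auto
        also have "\<dots> = 1" using v(2) Re_vinner_self[of V d v] by simp
        finally show ?thesis by (simp add: power_le_one_iff abs_square_le_1)
      qed
      then show ?thesis using v(1) by (auto simp: P_def is_vec_def)
    qed
    moreover have "is_vec V d v" if "v \<in> P" for v
      using that by (auto simp: P_def is_vec_def split: if_splits)
    ultimately show ?thesis by (auto simp: C_def)
  qed
  ultimately show ?thesis by simp
qed

text \<open>Maximise the quadratic form \<open>g\<close> of \<open>A\<close> over the unit vectors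
  orthogonal to the given eigenvectors. The defect \<open>n\<close> of the eigenvalue equation at a
  maximiser \<open>v\<close> is again orthogonal to them, so \<open>v + s n\<close> is an admissible
  variation, and stationarity forces \<open>n\<close> to vanish.\<close>

lemma exists_orthogonal_eigenvector:
  fixes A :: "'v qop"
  assumes fin: "finite V" and A: "self_adjoint V d A" and K: "K \<subset> cfgs V d"
    and orth: "\<forall>k\<in>K. \<forall>l\<in>K. vinner V d (u k) (u l) = (if k = l then 1 else 0)"
    and vec: "\<forall>k\<in>K. is_vec V d (u k)"
    and eig: "\<forall>k\<in>K. op_apply V d A (u k) = (\<lambda>x. complex_of_real (lam k) * u k x)"
  shows "\<exists>v \<mu>. is_vec V d v \<and> vinner V d v v = 1 \<and> (\<forall>k\<in>K. vinner V d (u k) v = 0) \<and>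
    op_apply V d A v = (\<lambda>x. complex_of_real \<mu> * v x)"
proof -
  define W where "W = {v :: 'v qvec. is_vec V d v \<and> vinner V d v v = 1 \<and> (\<forall>k\<in>K. vinner V d (u k) v = 0)}"
  define g where "g v = Re (vinner V d v (op_apply V d A v))" for v
  have "compact W" unfolding W_def by (rule compact_unit_vectors[OF fin])
  moreover have "W \<noteq> {}"
  proof -
    obtain v where "is_vec V d v" "vinner V d v v = 1" "\<forall>k\<in>K. vinner V d (u k) v = 0"
      using exists_orthogonal[OF fin K orth vec] by auto
    then have "v \<in> W" by (simp add: W_def)
    then show ?thesis by blast
  qed
  moreover have "continuous_on W g"
  proof -
    have cont: "continuous_on W (\<lambda>v :: 'v qvec. v x)" for x
      by (rule continuous_on_subset[OF continuous_on_product_coordinates]) auto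
    show ?thesis unfolding g_def vinner_def op_apply_def
      by (intro continuous_on_Re continuous_on_sum continuous_on_mult continuous_on_cnj
          continuous_on_const cont)
  qed
  ultimately obtain v where vW: "v \<in> W" and max: "\<And>w. w \<in> W \<Longrightarrow> g w \<le> g v"
    using continuous_attains_sup by metis
  have v: "is_vec V d v" "vinner V d v v = 1" "\<And>k. k \<in> K \<Longrightarrow> vinner V d (u k) v = 0"
    using vW by (auto simp: W_def)
  \<comment> \<open>By homogeneity the maximum property extends to vectors of any length, so the
    variation below need not be normalised.\<close>
  have gmax: "g w \<le> g v * Re (vinner V d w w)"
    if w: "is_vec V d w" "\<And>k. k \<in> K \<Longrightarrow> vinner V d (u k) w = 0" for w
  proof (cases "w = (\<lambda>_. 0)")
    case True
    then show ?thesis by (simp add: g_def vinner_def op_apply_def)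
  next
    case False
    define s where "s = Re (vinner V d w w)"
    have ws: "vinner V d w w = complex_of_real s"
      using vinner_self[of V d w] by (simp add: s_def)
    have "s \<noteq> 0" using False vinner_self_eq_0[OF fin w(1)] ws by auto
    moreover have "s \<ge> 0" unfolding s_def Re_vinner_self by (simp add: sum_nonneg)
    ultimately have s: "s > 0" by simp
    define w' where "w' = (\<lambda>x. complex_of_real (1 / sqrt s) * w x)"
    have quad: "vinner V d w' (op_apply V d B w') = complex_of_real (1 / s) * vinner V d w (op_apply V d B w)" for B
    proof -
      have "vinner V d w' (op_apply V d B w') =
          complex_of_real (1 / sqrt s * (1 / sqrt s)) * vinner V d w (op_apply V d B w)"
        unfolding of_real_mult
        by (simp add: w'_def vinner_def op_apply_def sum_distrib_left mult_ac)
      moreover have "1 / sqrt s * (1 / sqrt s) = 1 / s" using s by simp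
      ultimately show ?thesis by simp
    qed
    have "vinner V d w' w' = complex_of_real (1 / sqrt s * (1 / sqrt s)) * vinner V d w w"
      unfolding of_real_mult by (simp add: w'_def vinner_def sum_distrib_left mult_ac)
    also have "\<dots> = complex_of_real (1 / sqrt s * (1 / sqrt s) * s)" by (simp only: ws of_real_mult)
    also have "1 / sqrt s * (1 / sqrt s) * s = 1" using s by simp
    finally have "vinner V d w' w' = 1" by simp
    moreover have "vinner V d (u k) w' = 0" if "k \<in> K" for k
      unfolding w'_def vinner_scale_right using w(2)[OF that] by simp
    moreover have "is_vec V d w'" using w(1) by (simp add: w'_def is_vec_def)
    ultimately have "w' \<in> W" by (simp add: W_def)
    then have "g w' \<le> g v" by (rule max)
    moreover have "g w' = g w / s"
      unfolding g_def quad[of A] by simp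
    ultimately show ?thesis using s by (simp add: s_def[symmetric] field_simps)
  qed
  define n where "n = (\<lambda>x. op_apply V d A v x - complex_of_real (g v) * v x)"
  have Aop: "is_op V d A" using A by (simp add: self_adjoint_def)
  have nvec: "is_vec V d n" using v(1) Aop by (auto simp: n_def is_vec_def is_op_def op_apply_def)
  have north: "vinner V d (u k) n = 0" if k: "k \<in> K" for k
  proof -
    have "vinner V d (u k) (op_apply V d A v) = cnj (complex_of_real (lam k) * vinner V d v (u k))"
      using vinner_self_adjoint[OF A, of "u k" v] eig k by (simp add: vinner_scale_right)
    also have "\<dots> = 0" using v(3)[OF k] by (simp add: vinner_cnj)
    finally show ?thesis using v(3)[OF k]
      by (simp add: n_def vinner_diff_right vinner_scale_right)
  qed
  have gv: "vinner V d v (op_apply V d A v) = complex_of_real (g v)"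
    using vinner_self_adjoint[OF A, of v v] by (simp add: g_def complex_eq_iff)
  have vn: "vinner V d v n = 0"
    by (simp add: n_def vinner_diff_right vinner_scale_right gv v(2))
  then have nv: "vinner V d n v = 0" by (metis vinner_cnj complex_cnj_zero)
  have nA: "vinner V d n (op_apply V d A v) = vinner V d n n"
    by (subst (3) n_def) (simp add: vinner_diff_right vinner_scale_right nv)
  have vA: "vinner V d v (op_apply V d A n) = cnj (vinner V d n n)"
    using vinner_self_adjoint[OF A, of v n] by (simp add: nA)
  define N where "N = Re (vinner V d n n)"
  \<comment> \<open>This is \<open>gmax\<close> at \<open>v + s n\<close>. Both cross terms of the
    quadratic form equal the squared norm \<open>N\<close> of \<open>n\<close>, while those of the
    inner product vanish because \<open>n\<close> is orthogonal to \<open>v\<close>.\<close>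
  have "0 \<le> 2 * s * (- N) + s\<^sup>2 * (g v * N - g n)" for s :: real
  proof -
    define w where "w = (\<lambda>x. v x + complex_of_real s * n x)"
    have "g w \<le> g v * Re (vinner V d w w)"
      using v(1,3) nvec north
      by (intro gmax) (auto simp: w_def is_vec_def vinner_def sum.distrib distrib_left mult.left_commute simp flip: sum_distrib_left)
    moreover have "vinner V d w w = vinner V d v v + complex_of_real s * (vinner V d v n + vinner V d n v)
        + complex_of_real (s\<^sup>2) * vinner V d n n"
      by (simp add: w_def vinner_def sum.distrib sum_distrib_left algebra_simps power2_eq_square)
    moreover have "vinner V d w (op_apply V d A w) = vinner V d v (op_apply V d A v)
        + complex_of_real s * (vinner V d v (op_apply V d A n) + vinner V d n (op_apply V d A v))
        + complex_of_real (s\<^sup>2) * vinner V d n (op_apply V d A n)"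
      by (simp add: w_def vinner_def op_apply_def sum.distrib sum_distrib_left algebra_simps power2_eq_square)
    ultimately show ?thesis
      by (simp add: g_def[of w] nA vA gv v(2) vn nv N_def[symmetric] g_def[of n, symmetric]
          algebra_simps flip: of_real_power)
  qed
  then have "- N = 0" by (rule quadratic_nonneg_imp_linear_coeff_zero)
  then have "vinner V d n n = 0" using vinner_self[of V d n] by (simp add: N_def)
  then have "n = (\<lambda>_. 0)" by (rule vinner_self_eq_0[OF fin nvec])
  then have "op_apply V d A v = (\<lambda>x. complex_of_real (g v) * v x)"
    by (simp add: n_def fun_eq_iff)
  then show ?thesis using v by blast
qed

theorem spectral_theorem:
  fixes A :: "'v qop"
  assumes fin: "finite V" and A: "self_adjoint V d A"
  obtains u lam where "onb V d u" "A = diag_op V d u lam"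
proof -
  have finI: "finite (cfgs V d)" by (rule finite_cfgs[OF fin])
  have "\<exists>u lam. \<forall>k\<in>K. is_vec V d (u k) \<and> op_apply V d A (u k) = (\<lambda>x. complex_of_real (lam k) * u k x) \<and>
      (\<forall>l\<in>K. vinner V d (u k) (u l) = (if k = l then 1 else 0))"
    if "K \<subseteq> cfgs V d" for K
    using finite_subset[OF that finI] that
  proof (induction K rule: finite_induct)
    case empty
    then show ?case by simp
  next
    case (insert m K)
    then obtain u lam where IH: "\<forall>k\<in>K. is_vec V d (u k) \<and> 
      op_apply V d A (u k) = (\<lambda>x. complex_of_real (lam k) * u k x) \<and>
      (\<forall>l\<in>K. vinner V d (u k) (u l) = (if k = l then 1 else 0))" by auto
    have "K \<subset> cfgs V d" using insert by blast
    then obtain v \<mu> where v: "is_vec V d v" "vinner V d v v = 1" "\<forall>k\<in>K. vinner V d (u k) v = 0"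
      "op_apply V d A v = (\<lambda>x. complex_of_real \<mu> * v x)"
      using exists_orthogonal_eigenvector[OF fin A, of K u lam] IH by auto
    have "vinner V d v (u k) = 0" if "k \<in> K" for k
      using v(3) that by (metis vinner_cnj complex_cnj_zero)
    then show ?case using IH v insert(2)
      by (intro exI[of _ "u(m := v)"] exI[of _ "lam(m := \<mu>)"]) auto
  qed
  from this[OF subset_refl] obtain u lam where u: 
    "\<forall>k\<in>cfgs V d. is_vec V d (u k) \<and> op_apply V d A (u k) = (\<lambda>x. complex_of_real (lam k) * u k x) \<and>
      (\<forall>l\<in>cfgs V d. vinner V d (u k) (u l) = (if k = l then 1 else 0))" by blast
  then have onb: "onb V d u" by (simp add: onb_def)
  moreover have "A = diag_op V d u lam"
  proof (rule op_eqI_onb[OF fin onb onb])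
    fix k l assume k: "k \<in> cfgs V d" and l: "l \<in> cfgs V d"
    show "brk V d (u k) A (u l) = brk V d (u k) (diag_op V d u lam) (u l)"
      using u l by (simp add: brk_diag_onb_right[OF fin onb l]) (simp add: brk_def vinner_scale_right)
  qed (use A onb is_op_diag in \<open>auto simp: self_adjoint_def\<close>)
  ultimately show thesis by (rule that)
qed

subsection \<open>An upper bound on the relative entropy\<close>

lemma cmod_sum_mult_le:
  fixes f g :: "'i \<Rightarrow> complex"
  shows "(cmod (\<Sum>i\<in>I. f i * g i))\<^sup>2 \<le> (\<Sum>i\<in>I. (cmod (f i))\<^sup>2) * (\<Sum>i\<in>I. (cmod (g i))\<^sup>2)"
proof -
  have "cmod (\<Sum>i\<in>I. f i * g i) \<le> (\<Sum>i\<in>I. cmod (f i) * cmod (g i))"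
    by (rule order_trans[OF norm_sum]) (simp add: norm_mult)
  then have "(cmod (\<Sum>i\<in>I. f i * g i))\<^sup>2 \<le> (\<Sum>i\<in>I. cmod (f i) * cmod (g i))\<^sup>2"
    by (intro power_mono) auto
  also have "\<dots> \<le> (\<Sum>i\<in>I. (cmod (f i))\<^sup>2) * (\<Sum>i\<in>I. (cmod (g i))\<^sup>2)"
    by (rule Cauchy_Schwarz_ineq_sum)
  finally show ?thesis .
qed

text \<open>\<open>diag\<close> says that the \<open>y\<close>-weighted sum of the rank-one matrices
  built from the columns \<open>p _ k\<close> is diagonal with entries \<open>a\<close>. The
  conclusion evaluates its quadratic form, in which all cross terms cancel.\<close>

lemma sum_cmod_power2_diagonal:
  fixes p :: "'i \<Rightarrow> 'k \<Rightarrow> complex" and y :: "'k \<Rightarrow> real" and a :: "'i \<Rightarrow> real"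
  assumes fin: "finite I"
    and diag: "\<And>i j. i \<in> I \<Longrightarrow> j \<in> I \<Longrightarrow>
      (\<Sum>k\<in>K. complex_of_real (y k) * p i k * cnj (p j k)) = (if i = j then complex_of_real (a i) else 0)"
  shows "(\<Sum>k\<in>K. y k * (cmod (\<Sum>i\<in>I. v i * p i k))\<^sup>2) = (\<Sum>i\<in>I. (cmod (v i))\<^sup>2 * a i)"
proof -
  have "complex_of_real (\<Sum>k\<in>K. y k * (cmod (\<Sum>i\<in>I. v i * p i k))\<^sup>2) =
      (\<Sum>k\<in>K. complex_of_real (y k) * ((\<Sum>i\<in>I. v i * p i k) * cnj (\<Sum>j\<in>I. v j * p j k)))"
    unfolding of_real_sum of_real_mult complex_norm_square ..
  also have "\<dots> = (\<Sum>k\<in>K. \<Sum>i\<in>I. \<Sum>j\<in>I. v i * cnj (v j) * (complex_of_real (y k) * p i k * cnj (p j k)))"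
    unfolding cnj_sum sum_product by (simp add: sum_distrib_left mult_ac)
  also have "\<dots> = (\<Sum>i\<in>I. \<Sum>j\<in>I. v i * cnj (v j) * (\<Sum>k\<in>K. complex_of_real (y k) * p i k * cnj (p j k)))"
    unfolding sum_distrib_left by (subst sum.swap) (rule sum.cong[OF refl], rule sum.swap)
  also have "\<dots> = (\<Sum>i\<in>I. \<Sum>j\<in>I. if j = i then v i * cnj (v i) * complex_of_real (a i) else 0)"
    by (intro sum.cong refl) (simp add: diag)
  also have "\<dots> = (\<Sum>i\<in>I. v i * cnj (v i) * complex_of_real (a i))"
    using fin by simp
  also have "\<dots> = complex_of_real (\<Sum>i\<in>I. (cmod (v i))\<^sup>2 * a i)"
    unfolding of_real_sum of_real_mult complex_norm_square ..
  finally show ?thesis by (simp only: of_real_eq_iff)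
qed

text \<open>Both \<open>A\<close> and \<open>B\<close> are at least \<open>h\<^sup>2 / q\<close>, so
  the left-hand side is at most a concave quadratic in \<open>h\<close>; completing the square gives
  its maximum \<open>q / (y + t)\<close>.\<close>

lemma resolvent_scalar_bound:
  fixes h A B q y t :: real
  assumes "y > 0" "t > 0" "0 \<le> h" "0 \<le> A" "0 \<le> B" "0 \<le> q" and A: "h\<^sup>2 \<le> A * q" and B: "h\<^sup>2 \<le> B * q"
  shows "2 * h - y * A - t * B \<le> q / (y + t)"
proof (cases "q = 0")
  case True
  then have "h = 0" "q / (y + t) = 0" using A by simp_all
  moreover have "0 \<le> y * A" "0 \<le> t * B" using assms by simp_all
  ultimately show ?thesis by linarith
next
  case False
  then have q: "q > 0" using assms by simp
  have "y * h\<^sup>2 / q \<le> y * A" "t * h\<^sup>2 / q \<le> t * B"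
    using A B assms q by (auto simp: field_simps mult_left_mono)
  then have "2 * h - y * A - t * B \<le> 2 * h - (y + t) * h\<^sup>2 / q"
    by (simp add: add_divide_distrib distrib_right)
  also have "\<dots> = q / (y + t) - ((y + t) * h - q)\<^sup>2 / (q * (y + t))"
    using q assms(1,2) by (simp add: divide_simps power2_eq_square) (simp add: algebra_simps)
  also have "\<dots> \<le> q / (y + t)"
    using q assms(1,2) by simp
  finally show ?thesis .
qed

text \<open>The left-hand side is \<open>\<langle>\<omega>, (L\<^sub>\<rho> + t R\<^sub>\<omega>)\<inverse> \<omega>\<rangle>\<close> for left multiplication by \<open>\<rho>\<close> and right
  multiplication by \<open>\<omega>\<close>, hence the maximum of \<open>2 Re \<langle>Z, \<omega>\<rangle> - tr (Z\<^sup>* \<rho> Z) - t tr (Z \<omega> Z\<^sup>*)\<close>. For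
  \<open>\<omega> = \<Sum> |s\<^sub>k\<rangle>\<langle>s\<^sub>k|\<close>, \<open>\<rho> = \<Sum> y\<^sub>k |s\<^sub>k\<rangle>\<langle>s\<^sub>k|\<close> this splits into terms bounded by Cauchy-Schwarz; here
  \<open>\<alpha> i k = \<langle>v\<^sub>i|s\<^sub>k\<rangle>\<close>, \<open>\<beta> k j = \<langle>s\<^sub>k|w\<^sub>j\<rangle>\<close>, \<open>c i j = \<langle>v\<^sub>i|w\<^sub>j\<rangle>\<close> for eigenbases \<open>v\<close> of \<open>\<rho>\<close>, \<open>w\<close> of \<open>\<omega>\<close>.\<close>

lemma resolvent_inequality:
  fixes c \<alpha> \<beta> :: "'i \<Rightarrow> 'i \<Rightarrow> complex" and a b y q :: "'i \<Rightarrow> real" and t :: real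
  assumes fin: "finite I" and t: "t > 0"
    and pos: "\<And>i. i \<in> I \<Longrightarrow> a i > 0" "\<And>i. i \<in> I \<Longrightarrow> b i > 0" "\<And>i. i \<in> I \<Longrightarrow> y i > 0"
    and \<alpha>: "\<And>i j. i \<in> I \<Longrightarrow> j \<in> I \<Longrightarrow>
      (\<Sum>k\<in>I. complex_of_real (y k) * \<alpha> i k * cnj (\<alpha> j k)) = (if i = j then complex_of_real (a i) else 0)"
    and \<beta>: "\<And>i j. i \<in> I \<Longrightarrow> j \<in> I \<Longrightarrow>
      (\<Sum>k\<in>I. \<beta> k i * cnj (\<beta> k j)) = (if i = j then complex_of_real (b i) else 0)"
    and \<alpha>\<beta>: "\<And>i j. i \<in> I \<Longrightarrow> j \<in> I \<Longrightarrow> (\<Sum>k\<in>I. \<alpha> i k * \<beta> k j) = b j * c i j"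
    and q: "\<And>k. k \<in> I \<Longrightarrow> (\<Sum>i\<in>I. (cmod (\<alpha> i k))\<^sup>2) = q k" "\<And>k. k \<in> I \<Longrightarrow> (\<Sum>j\<in>I. (cmod (\<beta> k j))\<^sup>2) = q k"
  shows "(\<Sum>i\<in>I. \<Sum>j\<in>I. (cmod (c i j))\<^sup>2 * ((b j)\<^sup>2 / (a i + t * b j))) \<le> (\<Sum>k\<in>I. q k / (y k + t))"
proof -
  \<comment> \<open>These are the matrix elements of the maximiser \<open>Z\<close>: in the two
    eigenbases the superoperator multiplies entry \<open>(i, j)\<close> by
    \<open>a i + t * b j\<close>, and \<open>\<omega>\<close> has the entries
    \<open>b j * c i j\<close>.\<close>
  define z where "z i j = c i j * complex_of_real (b j / (a i + t * b j))" for i j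
  \<comment> \<open>In terms of the vectors \<open>s\<^sub>k\<close>, \<open>g k\<close> is the
    conjugate of \<open>\<langle>s\<^sub>k|Z|s\<^sub>k\<rangle>\<close>, \<open>A k\<close> is the
    squared norm of the adjoint of \<open>Z\<close> applied to \<open>s\<^sub>k\<close>, and
    \<open>B k\<close> that of \<open>Z\<close> applied to \<open>s\<^sub>k\<close>.\<close>
  define g where "g k = (\<Sum>i\<in>I. \<Sum>j\<in>I. cnj (z i j) * \<alpha> i k * \<beta> k j)" for k
  define A where "A k = (\<Sum>j\<in>I. (cmod (\<Sum>i\<in>I. cnj (z i j) * \<alpha> i k))\<^sup>2)" for k
  define B where "B k = (\<Sum>i\<in>I. (cmod (\<Sum>j\<in>I. cnj (z i j) * \<beta> k j))\<^sup>2)" for k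
  define M where "M = (\<Sum>i\<in>I. \<Sum>j\<in>I. (cmod (c i j))\<^sup>2 * ((b j)\<^sup>2 / (a i + t * b j)))"
  have ab: "a i + t * b j > 0" if "i \<in> I" "j \<in> I" for i j
    using pos that t by (simp add: add_pos_pos)
  have sum_g: "(\<Sum>k\<in>I. g k) = complex_of_real M"
  proof -
    have "(\<Sum>k\<in>I. g k) = (\<Sum>i\<in>I. \<Sum>j\<in>I. cnj (z i j) * (\<Sum>k\<in>I. \<alpha> i k * \<beta> k j))"
      unfolding g_def sum_distrib_left mult.assoc
      by (subst sum.swap) (rule sum.cong[OF refl], rule sum.swap)
    also have "\<dots> = (\<Sum>i\<in>I. \<Sum>j\<in>I. complex_of_real ((cmod (c i j))\<^sup>2 * ((b j)\<^sup>2 / (a i + t * b j))))"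
    proof (intro sum.cong refl)
      fix i j assume ij: "i \<in> I" "j \<in> I"
      have "cnj (z i j) * (\<Sum>k\<in>I. \<alpha> i k * \<beta> k j) = (c i j * cnj (c i j)) * complex_of_real (b j / (a i + t * b j) * b j)"
        by (simp add: \<alpha>\<beta>[OF ij] z_def mult_ac)
      then show "cnj (z i j) * (\<Sum>k\<in>I. \<alpha> i k * \<beta> k j) = complex_of_real ((cmod (c i j))\<^sup>2 * ((b j)\<^sup>2 / (a i + t * b j)))"
        unfolding of_real_mult complex_norm_square[symmetric] by (simp add: power2_eq_square)
    qed
    finally show ?thesis by (simp add: M_def)
  qed
  have sum_A: "(\<Sum>k\<in>I. y k * A k) = (\<Sum>i\<in>I. \<Sum>j\<in>I. (cmod (z i j))\<^sup>2 * a i)"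
  proof -
    have "(\<Sum>k\<in>I. y k * A k) = (\<Sum>j\<in>I. \<Sum>k\<in>I. y k * (cmod (\<Sum>i\<in>I. cnj (z i j) * \<alpha> i k))\<^sup>2)"
      unfolding A_def sum_distrib_left by (rule sum.swap)
    also have "\<dots> = (\<Sum>j\<in>I. \<Sum>i\<in>I. (cmod (z i j))\<^sup>2 * a i)"
      using sum_cmod_power2_diagonal[OF fin \<alpha>, of "\<lambda>i. cnj (z i _)"] by simp
    finally show ?thesis by (subst sum.swap)
  qed
  have sum_B: "(\<Sum>k\<in>I. B k) = (\<Sum>i\<in>I. \<Sum>j\<in>I. (cmod (z i j))\<^sup>2 * b j)"
  proof -
    have "(\<Sum>k\<in>I. B k) = (\<Sum>i\<in>I. \<Sum>k\<in>I. (cmod (\<Sum>j\<in>I. cnj (z i j) * \<beta> k j))\<^sup>2)"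
      unfolding B_def by (rule sum.swap)
    also have "\<dots> = (\<Sum>i\<in>I. \<Sum>j\<in>I. (cmod (z i j))\<^sup>2 * b j)"
      using sum_cmod_power2_diagonal[OF fin, where K = I and y = "\<lambda>_. 1" and p = "\<lambda>j k. \<beta> k j" and a = b and v = "\<lambda>j. cnj (z _ j)"] \<beta> by simp
    finally show ?thesis .
  qed
  have "(\<Sum>k\<in>I. y k * A k) + t * (\<Sum>k\<in>I. B k) = (\<Sum>i\<in>I. \<Sum>j\<in>I. (cmod (z i j))\<^sup>2 * (a i + t * b j))"
    unfolding sum_A sum_B by (simp add: sum_distrib_left sum.distrib[symmetric] algebra_simps)
  also have "\<dots> = M"
    unfolding M_def
  proof (intro sum.cong refl)
    fix i j assume ij: "i \<in> I" "j \<in> I"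
    have "(cmod (z i j))\<^sup>2 = (cmod (c i j))\<^sup>2 * (b j / (a i + t * b j))\<^sup>2"
      unfolding z_def norm_mult norm_of_real power_mult_distrib power2_abs ..
    then show "(cmod (z i j))\<^sup>2 * (a i + t * b j) = (cmod (c i j))\<^sup>2 * ((b j)\<^sup>2 / (a i + t * b j))"
      using ab[OF ij] by (simp add: power_divide power2_eq_square[of "a i + t * b j"])
  qed
  finally have AB: "(\<Sum>k\<in>I. y k * A k) + t * (\<Sum>k\<in>I. B k) = M" .
  \<comment> \<open>At the maximiser the linear pairing and the quadratic part both equal
    \<open>M\<close>; writing \<open>M\<close> as \<open>2 * M - M\<close> gives an expression that
    splits over \<open>k\<close>.\<close>
  have "M = 2 * Re (\<Sum>k\<in>I. g k) - (\<Sum>k\<in>I. y k * A k) - t * (\<Sum>k\<in>I. B k)"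
    using AB by (simp add: sum_g)
  also have "\<dots> = (\<Sum>k\<in>I. 2 * Re (g k) - y k * A k - t * B k)"
    by (simp add: sum_subtractf sum_distrib_left)
  also have "\<dots> \<le> (\<Sum>k\<in>I. q k / (y k + t))"
  proof (rule sum_mono)
    fix k assume k: "k \<in> I"
    have "g k = (\<Sum>j\<in>I. (\<Sum>i\<in>I. cnj (z i j) * \<alpha> i k) * \<beta> k j)"
      unfolding g_def sum_distrib_right by (rule sum.swap)
    then have gA: "(cmod (g k))\<^sup>2 \<le> A k * q k"
      using cmod_sum_mult_le[of "\<lambda>j. \<Sum>i\<in>I. cnj (z i j) * \<alpha> i k" "\<beta> k" I] q(2)[OF k] by (simp add: A_def)
    have "g k = (\<Sum>i\<in>I. (\<Sum>j\<in>I. cnj (z i j) * \<beta> k j) * \<alpha> i k)"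
      unfolding g_def sum_distrib_right by (simp add: mult_ac)
    then have gB: "(cmod (g k))\<^sup>2 \<le> B k * q k"
      using cmod_sum_mult_le[of "\<lambda>i. \<Sum>j\<in>I. cnj (z i j) * \<beta> k j" "\<lambda>i. \<alpha> i k" I] q(1)[OF k] by (simp add: B_def)
    have "0 \<le> q k" unfolding q(1)[OF k, symmetric] by (simp add: sum_nonneg)
    then have "2 * cmod (g k) - y k * A k - t * B k \<le> q k / (y k + t)"
      using gA gB pos(3)[OF k] t by (intro resolvent_scalar_bound) (auto simp: A_def B_def sum_nonneg)
    then show "2 * Re (g k) - y k * A k - t * B k \<le> q k / (y k + t)"
      using complex_Re_le_cmod[of "g k"] by linarith
  qed
  finally show ?thesis by (simp add: M_def)
qed

text \<open>Integrating the resolvent inequality over \<open>t\<close>: \<open>D t\<close> below tends to \<open>0\<close> at infinity and decreases,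
  so \<open>D 0 \<ge> 0\<close>.\<close>

lemma relative_entropy_le_classical:
  fixes c \<alpha> \<beta> :: "'i \<Rightarrow> 'i \<Rightarrow> complex" and a b y q :: "'i \<Rightarrow> real"
  assumes fin: "finite I"
    and pos: "\<And>i. i \<in> I \<Longrightarrow> a i > 0" "\<And>i. i \<in> I \<Longrightarrow> b i > 0" "\<And>i. i \<in> I \<Longrightarrow> y i > 0"
    and \<alpha>: "\<And>i j. i \<in> I \<Longrightarrow> j \<in> I \<Longrightarrow>
      (\<Sum>k\<in>I. complex_of_real (y k) * \<alpha> i k * cnj (\<alpha> j k)) = (if i = j then complex_of_real (a i) else 0)"
    and \<beta>: "\<And>i j. i \<in> I \<Longrightarrow> j \<in> I \<Longrightarrow>
      (\<Sum>k\<in>I. \<beta> k i * cnj (\<beta> k j)) = (if i = j then complex_of_real (b i) else 0)"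
    and \<alpha>\<beta>: "\<And>i j. i \<in> I \<Longrightarrow> j \<in> I \<Longrightarrow> (\<Sum>k\<in>I. \<alpha> i k * \<beta> k j) = b j * c i j"
    and q: "\<And>k. k \<in> I \<Longrightarrow> (\<Sum>i\<in>I. (cmod (\<alpha> i k))\<^sup>2) = q k" "\<And>k. k \<in> I \<Longrightarrow> (\<Sum>j\<in>I. (cmod (\<beta> k j))\<^sup>2) = q k"
    and c: "\<And>i. i \<in> I \<Longrightarrow> (\<Sum>j\<in>I. (cmod (c i j))\<^sup>2) = 1" "\<And>j. j \<in> I \<Longrightarrow> (\<Sum>i\<in>I. (cmod (c i j))\<^sup>2) = 1"
    and tr: "(\<Sum>i\<in>I. a i) = 1" "(\<Sum>i\<in>I. b i) = 1" "(\<Sum>k\<in>I. q k * y k) = 1" "(\<Sum>k\<in>I. q k) = 1"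
  shows "(\<Sum>i\<in>I. \<Sum>j\<in>I. (cmod (c i j))\<^sup>2 * (a i * (ln (a i) - ln (b j)))) \<le> (\<Sum>k\<in>I. q k * (y k * ln (y k)))"
proof -
  define w where "w i j = (cmod (c i j))\<^sup>2" for i j
  \<comment> \<open>Here \<open>ln (a / b)\<close> is the integral of
    \<open>1 / (1 + t) - b / (a + t * b)\<close> over positive \<open>t\<close>. \<open>D t\<close>
    is the part of the classical entropy integral beyond \<open>t\<close> minus the same part of the
    quantum one, and \<open>D 0\<close> is the full difference.\<close>
  define D where "D t = (\<Sum>i\<in>I. \<Sum>j\<in>I. w i j * (a i * (ln (1 + t) + ln (b j) - ln (a i + t * b j)))) -
    (\<Sum>k\<in>I. q k * (y k * (ln (1 + t) - ln (y k + t))))" for t :: real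
  define D' where "D' t = (\<Sum>i\<in>I. \<Sum>j\<in>I. w i j * (a i * (1 / (1 + t) - b j / (a i + t * b j)))) -
    (\<Sum>k\<in>I. q k * (y k * (1 / (1 + t) - 1 / (y k + t))))" for t :: real
  have ab: "a i + t * b j > 0" if "i \<in> I" "j \<in> I" "t \<ge> 0" for i j t
    using pos(1)[OF that(1)] pos(2)[OF that(2)] that(3) by (simp add: add_pos_nonneg)
  have wa: "(\<Sum>i\<in>I. (\<Sum>j\<in>I. w i j) * a i) = 1"
    using c(1) tr(1) by (simp add: w_def)
  have wb: "(\<Sum>i\<in>I. \<Sum>j\<in>I. w i j * b j) = 1"
    using c(2) tr(2) by (subst sum.swap) (simp add: w_def flip: sum_distrib_right)
  have deriv: "(D has_real_derivative D' t) (at t)" if t: "t \<ge> 0" for t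
    unfolding D_def D'_def
  proof (rule DERIV_diff; intro DERIV_sum DERIV_cmult)
    show "((\<lambda>t. ln (1 + t) + ln (b j) - ln (a i + t * b j)) has_real_derivative
        1 / (1 + t) - b j / (a i + t * b j)) (at t)" if "i \<in> I" "j \<in> I" for i j
      using ab[OF that t] t by (auto intro!: derivative_eq_intros)
    show "((\<lambda>t. ln (1 + t) - ln (y k + t)) has_real_derivative
        1 / (1 + t) - 1 / (y k + t)) (at t)" if "k \<in> I" for k
      using add_pos_nonneg[OF pos(3)[OF that] t] t by (auto intro!: derivative_eq_intros)
  qed
  \<comment> \<open>Since \<open>a * b / (a + t * b) = b - t * b\<^sup>2 / (a + t * b)\<close>, and
    likewise for \<open>y k\<close>, the normalisations turn both sums into
    \<open>1 / (1 + t) - 1\<close> plus \<open>t\<close> times a side of the resolvent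
    inequality.\<close>
  have D'_le: "D' t \<le> 0" if t: "t > 0" for t
  proof -
    have "(\<Sum>i\<in>I. \<Sum>j\<in>I. w i j * (a i * (1 / (1 + t) - b j / (a i + t * b j)))) =
        (\<Sum>i\<in>I. \<Sum>j\<in>I. w i j * a i * (1 / (1 + t)) - w i j * b j + t * (w i j * ((b j)\<^sup>2 / (a i + t * b j))))"
    proof (intro sum.cong refl)
      fix i j assume ij: "i \<in> I" "j \<in> I"
      have "a i * (b j / (a i + t * b j)) = b j - t * ((b j)\<^sup>2 / (a i + t * b j))"
        using ab[OF ij, of t] t by (simp add: field_simps power2_eq_square)
      then have "a i * (1 / (1 + t) - b j / (a i + t * b j)) = a i * (1 / (1 + t)) - (b j - t * ((b j)\<^sup>2 / (a i + t * b j)))"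
        by (simp only: right_diff_distrib)
      then show "w i j * (a i * (1 / (1 + t) - b j / (a i + t * b j))) =
         w i j * a i * (1 / (1 + t)) - w i j * b j + t * (w i j * ((b j)\<^sup>2 / (a i + t * b j)))"
        by (simp only:) (simp add: algebra_simps)
    qed
    also have "\<dots> = 1 / (1 + t) - 1 + t * (\<Sum>i\<in>I. \<Sum>j\<in>I. w i j * ((b j)\<^sup>2 / (a i + t * b j)))"
      unfolding sum.distrib sum_subtractf sum_distrib_right[symmetric] sum_distrib_left[symmetric] wa wb by simp
    finally have 1: "(\<Sum>i\<in>I. \<Sum>j\<in>I. w i j * (a i * (1 / (1 + t) - b j / (a i + t * b j)))) = \<dots>" .
    have "(\<Sum>k\<in>I. q k * (y k * (1 / (1 + t) - 1 / (y k + t)))) =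
        (\<Sum>k\<in>I. q k * y k * (1 / (1 + t)) - q k + t * (q k / (y k + t)))"
    proof (intro sum.cong refl)
      fix k assume k: "k \<in> I"
      have "y k + t > 0" using pos(3)[OF k] t by simp
      then have "y k * (1 / (y k + t)) = 1 - t * (1 / (y k + t))"
        by (simp add: field_simps)
      then have "y k * (1 / (1 + t) - 1 / (y k + t)) = y k * (1 / (1 + t)) - (1 - t * (1 / (y k + t)))"
        by (simp only: right_diff_distrib)
      then show "q k * (y k * (1 / (1 + t) - 1 / (y k + t))) = q k * y k * (1 / (1 + t)) - q k + t * (q k / (y k + t))"
        by (simp only:) (simp add: algebra_simps)
    qed
    also have "\<dots> = 1 / (1 + t) - 1 + t * (\<Sum>k\<in>I. q k / (y k + t))"
      unfolding sum.distrib sum_subtractf sum_distrib_right[symmetric] sum_distrib_left[symmetric] tr by simp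
    finally have 2: "(\<Sum>k\<in>I. q k * (y k * (1 / (1 + t) - 1 / (y k + t)))) = \<dots>" .
    have "(\<Sum>i\<in>I. \<Sum>j\<in>I. w i j * ((b j)\<^sup>2 / (a i + t * b j))) \<le> (\<Sum>k\<in>I. q k / (y k + t))"
      unfolding w_def by (rule resolvent_inequality[OF fin t pos \<alpha> \<beta> \<alpha>\<beta> q])
    then show ?thesis unfolding D'_def 1 2 using t by (simp add: mult_left_mono)
  qed
  have mono: "D t \<le> D 0" if "t \<ge> 0" for t
  proof (rule DERIV_nonpos_imp_decreasing_open[OF that])
    show "\<exists>y. (D has_real_derivative y) (at x) \<and> y \<le> 0" if "0 < x" "x < t" for x
      using deriv[of x] D'_le[of x] that by auto
    show "continuous_on {0..t} D"
      by (rule DERIV_continuous_on, rule DERIV_subset, rule deriv) auto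
  qed
  have "(D \<longlongrightarrow> 0) at_top"
  proof -
    have lim1: "((\<lambda>t. ln (1 + t) + ln B - ln (A + t * B)) \<longlongrightarrow> 0) at_top" if "A > 0" "B > 0" for A B :: real
    proof -
      have "((\<lambda>t. ln ((1 + t) * B / (A + t * B))) \<longlongrightarrow> ln 1) at_top"
        using that by (intro tendsto_ln) (real_asymp, simp)
      moreover have "\<forall>\<^sub>F t in at_top. ln ((1 + t) * B / (A + t * B)) = ln (1 + t) + ln B - ln (A + t * B)"
        using eventually_ge_at_top[of 0]
      proof eventually_elim
        case (elim t)
        have "A + t * B > 0" using that elim by (simp add: add_pos_nonneg)
        then show ?case using that elim by (simp add: ln_div ln_mult)
      qed
      ultimately show ?thesis by (simp add: filterlim_cong)
    qed
    have "(D \<longlongrightarrow> (\<Sum>i\<in>I. \<Sum>j\<in>I. w i j * (a i * 0)) - (\<Sum>k\<in>I. q k * (y k * 0))) at_top"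
      unfolding D_def
    proof (intro tendsto_diff tendsto_sum tendsto_mult tendsto_const)
      show "((\<lambda>t. ln (1 + t) + ln (b j) - ln (a i + t * b j)) \<longlongrightarrow> 0) at_top" if "i \<in> I" "j \<in> I" for i j
        using lim1 pos that by blast
      show "((\<lambda>t. ln (1 + t) - ln (y k + t)) \<longlongrightarrow> 0) at_top" if "k \<in> I" for k
        using lim1[of "y k" 1] pos that by simp
    qed
    then show ?thesis by simp
  qed
  then have "0 \<le> D 0"
    by (rule tendsto_upperbound) (auto intro!: eventually_mono[OF eventually_ge_at_top[of 0]] mono)
  also have "D 0 = (\<Sum>k\<in>I. q k * (y k * ln (y k))) - (\<Sum>i\<in>I. \<Sum>j\<in>I. w i j * (a i * (ln (a i) - ln (b j))))"
    unfolding D_def by (simp add: right_diff_distrib sum_subtractf sum_negf)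
  finally show ?thesis by (simp add: w_def)
qed

subsection \<open>The Lipschitz constant and the transport distance\<close>

lemma vnorm_eq_L2_set: "vnorm V d v = L2_set (\<lambda>x. cmod (v x)) (cfgs V d)"
  by (simp add: vnorm_def L2_set_def)

text \<open>\<open>op_norm\<close> is a supremum of reals, which is informative only for a bounded
  set; the crude bound by the sum of all entries is enough.\<close>

lemma bdd_above_op_norm:
  assumes fin: "finite V"
  shows "bdd_above {vnorm V d (op_apply V d A v) | v. is_vec V d v \<and> vnorm V d v = 1}"
proof (rule bdd_aboveI, safe)
  fix v :: "'a qvec" assume v: "vnorm V d v = 1"
  have v1: "cmod (v y) \<le> 1" if "y \<in> cfgs V d" for y
    using member_le_L2_set[OF finite_cfgs[OF fin] that, of "\<lambda>x. cmod (v x)"] v by (simp add: vnorm_eq_L2_set)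
  have "vnorm V d (op_apply V d A v) \<le> (\<Sum>x\<in>cfgs V d. cmod (op_apply V d A v x))"
    unfolding vnorm_eq_L2_set by (rule L2_set_le_sum) simp
  also have "\<dots> \<le> (\<Sum>x\<in>cfgs V d. \<Sum>y\<in>cfgs V d. cmod (A x y))"
    unfolding op_apply_def
    by (intro sum_mono order_trans[OF norm_sum]) (use v1 in \<open>auto simp: norm_mult mult_left_le\<close>)
  finally show "vnorm V d (op_apply V d A v) \<le> (\<Sum>x\<in>cfgs V d. \<Sum>y\<in>cfgs V d. cmod (A x y))" .
qed

lemma cmod_entry_le_op_norm:
  assumes fin: "finite V" and x: "x \<in> cfgs V d" and y: "y \<in> cfgs V d"
  shows "cmod (A x y) \<le> op_norm V d A"
proof -
  define v :: "'a qvec" where "v = (\<lambda>z. if z = y then 1 else 0)"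
  have "is_vec V d v" "vnorm V d v = 1"
    using y finite_cfgs[OF fin] by (auto simp: v_def is_vec_def vnorm_def if_distrib[of cmod] if_distrib[of "\<lambda>a. a\<^sup>2"] cong: if_cong)
  then have le: "vnorm V d (op_apply V d A v) \<le> op_norm V d A"
    unfolding op_norm_def by (intro cSup_upper bdd_above_op_norm[OF fin]) auto
  have "op_apply V d A v z = A z y" for z
    unfolding op_apply_def v_def using y finite_cfgs[OF fin] by (simp add: if_distrib cong: if_cong)
  then have "cmod (A x y) \<le> vnorm V d (op_apply V d A v)"
    using member_le_L2_set[OF finite_cfgs[OF fin] x, of "\<lambda>z. cmod (A z y)"] by (simp add: vnorm_eq_L2_set)
  then show ?thesis using le by simp
qed

lemma op_norm_nonneg:
  assumes "finite V" "cfgs V d \<noteq> {}"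
  shows "0 \<le> op_norm V d A"
  using assms cmod_entry_le_op_norm[OF assms(1)] by (meson all_not_in_conv norm_ge_zero order_trans)

lemma op_norm_scale_le:
  fixes V :: "'v set" and A :: "'v qop"
  assumes fin: "finite V" and ne: "cfgs V d \<noteq> {}"
  shows "op_norm V d (op_scale (complex_of_real a) A) \<le> \<bar>a\<bar> * op_norm V d A"
  unfolding op_norm_def[of V d "op_scale _ _"]
proof (rule cSup_least, goal_cases)
  case 1
  obtain y where y: "y \<in> cfgs V d" using ne by blast
  define v :: "'v qvec" where "v = (\<lambda>z. if z = y then 1 else 0)"
  have "is_vec V d v" "vnorm V d v = 1"
    using y finite_cfgs[OF fin] by (auto simp: v_def is_vec_def vnorm_def if_distrib[of cmod] if_distrib[of "\<lambda>a. a\<^sup>2"] cong: if_cong)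
  then show ?case by blast
next
  case (2 n)
  then obtain v where v: "n = vnorm V d (op_apply V d (op_scale (complex_of_real a) A) v)" "is_vec V d v" "vnorm V d v = 1"
    by blast
  have "op_apply V d (op_scale (complex_of_real a) A) v = (\<lambda>x. complex_of_real a * op_apply V d A v x)"
    by (simp add: op_apply_def op_scale_def sum_distrib_left mult.assoc)
  then have "n = \<bar>a\<bar> * vnorm V d (op_apply V d A v)"
    using v(1) by (simp add: vnorm_eq_L2_set norm_mult L2_set_right_distrib)
  also have "vnorm V d (op_apply V d A v) \<le> op_norm V d A"
    unfolding op_norm_def using v by (intro cSup_upper bdd_above_op_norm[OF fin]) auto
  finally show ?case by (simp add: mult_left_mono)
qed

definition site_dev :: "'v set \<Rightarrow> nat \<Rightarrow> 'v qop \<Rightarrow> 'v \<Rightarrow> real set" where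
  "site_dev V d H i = {op_norm V d (op_diff H H') | H'. self_adjoint V d H' \<and> acts_trivially V d i H'}"

lemma lip_eq: "lip V d H = 2 * Max (insert 0 ((\<lambda>i. Inf (site_dev V d H i)) ` V))"
  by (simp add: lip_def site_dev_def)

lemma site_dev_nonempty: "site_dev V d H i \<noteq> {}"
proof -
  have "self_adjoint V d (\<lambda>_ _. 0)" "acts_trivially V d i (\<lambda>_ _. 0)"
    by (auto simp: self_adjoint_def is_op_def op_adj_def acts_trivially_def)
  then show ?thesis by (auto simp: site_dev_def)
qed

lemma bdd_below_site_dev:
  assumes "finite V" "cfgs V d \<noteq> {}"
  shows "bdd_below (site_dev V d H i)"
  by (rule bdd_belowI[of _ 0]) (auto simp: site_dev_def op_norm_nonneg[OF assms])

lemma lip_scale_le: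
  fixes V :: "'v set" and H :: "'v qop"
  assumes fin: "finite V" and ne: "cfgs V d \<noteq> {}" and a: "a \<noteq> 0"
  shows "lip V d (op_scale (complex_of_real a) H) \<le> \<bar>a\<bar> * lip V d H"
proof -
  let ?m = "Max (insert 0 ((\<lambda>i. Inf (site_dev V d H i)) ` V))"
  have "Inf (site_dev V d (op_scale (complex_of_real a) H) i) \<le> \<bar>a\<bar> * Inf (site_dev V d H i)" for i
  proof -
    have "Inf (site_dev V d (op_scale (complex_of_real a) H) i) / \<bar>a\<bar> \<le> Inf (site_dev V d H i)"
    proof (rule cInf_greatest[OF site_dev_nonempty])
      fix n assume "n \<in> site_dev V d H i"
      then obtain H' where H': "n = op_norm V d (op_diff H H')" "self_adjoint V d H'" "acts_trivially V d i H'"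
        by (auto simp: site_dev_def)
      have "self_adjoint V d (op_scale (complex_of_real a) H')"
        using H'(2) by (auto simp: self_adjoint_def is_op_def op_adj_def op_scale_def fun_eq_iff)
      moreover have "acts_trivially V d i (op_scale (complex_of_real a) H')"
        using H'(3) by (auto simp: acts_trivially_def op_scale_def)
      moreover have "op_diff (op_scale (complex_of_real a) H) (op_scale (complex_of_real a) H') =
          op_scale (complex_of_real a) (op_diff H H')"
        by (auto simp: op_diff_def op_scale_def right_diff_distrib)
      ultimately have "op_norm V d (op_scale (complex_of_real a) (op_diff H H')) \<in> site_dev V d (op_scale (complex_of_real a) H) i"
        unfolding site_dev_def by (smt (verit, best) mem_Collect_eq)
      then have "Inf (site_dev V d (op_scale (complex_of_real a) H) i) \<le> op_norm V d (op_scale (complex_of_real a) (op_diff H H'))"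
        by (rule cInf_lower[OF _ bdd_below_site_dev[OF fin ne]])
      also have "\<dots> \<le> \<bar>a\<bar> * n" unfolding H'(1) by (rule op_norm_scale_le[OF fin ne])
      finally show "Inf (site_dev V d (op_scale (complex_of_real a) H) i) / \<bar>a\<bar> \<le> n"
        using a by (simp add: field_simps)
    qed
    then show ?thesis using a by (simp add: field_simps)
  qed
  moreover have "Inf (site_dev V d H i) \<le> ?m" if "i \<in> V" for i
    using fin that by (intro Max_ge) auto
  ultimately have "Inf (site_dev V d (op_scale (complex_of_real a) H) i) \<le> \<bar>a\<bar> * ?m" if "i \<in> V" for i
    using that by (meson abs_ge_zero mult_left_mono order_trans)
  moreover have "0 \<le> \<bar>a\<bar> * ?m" using fin by (simp add: Max_ge)
  ultimately have "Max (insert 0 ((\<lambda>i. Inf (site_dev V d (op_scale (complex_of_real a) H) i)) ` V)) \<le> \<bar>a\<bar> * ?m"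
    using fin by (intro Max.boundedI) auto
  then show ?thesis by (simp add: lip_eq)
qed

lemma lip_nonneg:
  assumes "finite V"
  shows "0 \<le> lip V d H"
  using assms by (simp add: lip_eq Max_ge)

section \<open>Boundedness of the set of test values behind the transport distance\<close>

text \<open>The factor 2 in \<open>lip\<close> bounds the infimum by 1/2. The bound 1 leaves strict
  room, so attainment of the infimum need not be shown.\<close>

lemma lip_le_1_approx:
  assumes fin: "finite V" and H: "lip V d H \<le> 1" and i: "i \<in> V"
  shows "\<exists>H'. acts_trivially V d i H' \<and> op_norm V d (op_diff H H') < 1"
proof -
  have "Inf (site_dev V d H i) \<le> Max (insert 0 ((\<lambda>i. Inf (site_dev V d H i)) ` V))"
    using fin i by (intro Max_ge) auto
  then have "Inf (site_dev V d H i) < 1" using H by (simp add: lip_eq)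
  from cInf_lessD[OF site_dev_nonempty this] obtain n where "n \<in> site_dev V d H i" "n < 1"
    by blast
  then show ?thesis by (auto simp: site_dev_def)
qed

text \<open>Configurations that differ at a site \<open>i\<close> have matrix element 0 in any
  operator acting trivially on \<open>i\<close>, so the entry of \<open>H\<close> is pure
  approximation error.\<close>

lemma lip_le_1_offdiag:
  assumes fin: "finite V" and H: "lip V d H \<le> 1" and xy: "x \<in> cfgs V d" "y \<in> cfgs V d" "x \<noteq> y"
  shows "cmod (H x y) \<le> 1"
proof -
  obtain i where i: "x i \<noteq> y i" using xy(3) by auto
  then have "i \<in> V" using xy by (auto simp: cfgs_def)
  then obtain H' where H': "acts_trivially V d i H'" "op_norm V d (op_diff H H') < 1"
    using lip_le_1_approx[OF fin H] by blast
  have "H' x y = 0" using H'(1) i xy by (auto simp: acts_trivially_def)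
  then show ?thesis using cmod_entry_le_op_norm[OF fin xy(1,2), of "op_diff H H'"] H'(2)
    by (simp add: op_diff_def)
qed

lemma lip_le_1_diag_step:
  assumes fin: "finite V" and H: "lip V d H \<le> 1" and i: "i \<in> V" and x: "x \<in> cfgs V d"
  shows "cmod (H x x - H (x(i := 0)) (x(i := 0))) \<le> 2"
proof -
  obtain H' where H': "acts_trivially V d i H'" "op_norm V d (op_diff H H') < 1"
    using lip_le_1_approx[OF fin H i] by blast
  have x0: "x(i := 0) \<in> cfgs V d" using x i by (fastforce simp: cfgs_def)
  have H'x: "H' x x = H' (x(i := 0)) (x(i := 0))" using H'(1) x by (auto simp: acts_trivially_def)
  have "cmod (H x x - H' x x) < 1"
    using cmod_entry_le_op_norm[OF fin x x, of "op_diff H H'"] H'(2) by (simp add: op_diff_def)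
  moreover have "cmod (H (x(i := 0)) (x(i := 0)) - H' x x) < 1"
    using cmod_entry_le_op_norm[OF fin x0 x0, of "op_diff H H'"] H'(2) H'x by (simp add: op_diff_def)
  ultimately show ?thesis
    using norm_triangle_ineq4[of "H x x - H' x x" "H (x(i := 0)) (x(i := 0)) - H' x x"] by simp
qed

text \<open>Reset the sites to 0 one after the other; an operator acting trivially on the reset site
  does not see the change, so each step costs two approximation errors.\<close>

lemma lip_le_1_diag:
  assumes fin: "finite V" and H: "lip V d H \<le> 1" and x: "x \<in> cfgs V d"
  shows "cmod (H x x - H (\<lambda>_. 0) (\<lambda>_. 0)) \<le> 2 * card V"
proof -
  have *: "cmod (H x x - H (\<lambda>v. if v \<in> S then 0 else x v) (\<lambda>v. if v \<in> S then 0 else x v)) \<le> 2 * card S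
      \<and> (\<lambda>v. if v \<in> S then 0 else x v) \<in> cfgs V d" if "S \<subseteq> V" for S
    using finite_subset[OF that fin] that
  proof (induction S rule: finite_induct)
    case empty
    then show ?case using x by simp
  next
    case (insert i S)
    let ?x = "\<lambda>v. if v \<in> S then 0 else x v"
    have up: "(\<lambda>v. if v \<in> insert i S then 0 else x v) = ?x(i := 0)" by auto
    have IH: "cmod (H x x - H ?x ?x) \<le> 2 * card S" "?x \<in> cfgs V d" using insert by auto
    have "cmod (H x x - H (?x(i := 0)) (?x(i := 0))) \<le> cmod (H x x - H ?x ?x) + cmod (H ?x ?x - H (?x(i := 0)) (?x(i := 0)))"
      using norm_triangle_ineq[of "H x x - H ?x ?x" "H ?x ?x - H (?x(i := 0)) (?x(i := 0))"] by simp
    also have "\<dots> \<le> 2 * card S + 2"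
      using IH lip_le_1_diag_step[OF fin H _ IH(2), of i] insert by auto
    finally have "cmod (H x x - H (?x(i := 0)) (?x(i := 0))) \<le> 2 * card (insert i S)"
      using insert by simp
    moreover have "?x(i := 0) \<in> cfgs V d" using IH(2) insert by (fastforce simp: cfgs_def)
    ultimately show ?case by (simp only: up)
  qed
  have "(\<lambda>v. if v \<in> V then 0 else x v) = (\<lambda>_. 0)" using x by (auto simp: cfgs_def)
  then show ?thesis using *[of V] by simp
qed

text \<open>Boundedness makes the supremum in \<open>W1\<close> an actual upper bound for each test
  observable. The Lipschitz condition controls \<open>H\<close> only up to multiples of the
  identity; as \<open>T\<close> is traceless, the reference entry \<open>h\<close> can be subtracted
  from the diagonal, after which all entries are bounded.\<close>

lemma bdd_above_W1:
  assumes fin: "finite V" and T: "tr V d T = 0"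
  shows "bdd_above {Re (tr V d (op_mult V d T H)) | H. self_adjoint V d H \<and> lip V d H \<le> 1}"
proof (rule bdd_aboveI, safe)
  fix H assume H: "lip V d H \<le> 1"
  define h where "h = H (\<lambda>_. 0) (\<lambda>_. 0)"
  have "(\<Sum>x\<in>cfgs V d. \<Sum>z\<in>cfgs V d. T x z * (if z = x then h else 0)) = (\<Sum>x\<in>cfgs V d. T x x * h)"
    using finite_cfgs[OF fin] by (simp add: if_distrib cong: if_cong)
  also have "\<dots> = 0" using T by (simp add: tr_def flip: sum_distrib_right)
  finally have "tr V d (op_mult V d T H) = (\<Sum>x\<in>cfgs V d. \<Sum>z\<in>cfgs V d. T x z * (H z x - (if z = x then h else 0)))"
    by (simp add: tr_def op_mult_def right_diff_distrib sum_subtractf)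
  then have "Re (tr V d (op_mult V d T H)) \<le> cmod (\<Sum>x\<in>cfgs V d. \<Sum>z\<in>cfgs V d. T x z * (H z x - (if z = x then h else 0)))"
    by (metis complex_Re_le_cmod)
  also have "\<dots> \<le> (\<Sum>x\<in>cfgs V d. \<Sum>z\<in>cfgs V d. cmod (T x z) * (2 * card V + 1))"
  proof (intro order_trans[OF norm_sum] sum_mono)
    fix x z assume xz: "x \<in> cfgs V d" "z \<in> cfgs V d"
    have "cmod (H z x - (if z = x then h else 0)) \<le> 2 * card V + 1"
      using lip_le_1_diag[OF fin H xz(1)] lip_le_1_offdiag[OF fin H xz(2,1)] by (auto simp: h_def)
    then show "cmod (T x z * (H z x - (if z = x then h else 0))) \<le> cmod (T x z) * (2 * card V + 1)"
      unfolding norm_mult by (intro mult_left_mono) auto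
  qed
  finally show "Re (tr V d (op_mult V d T H)) \<le> (\<Sum>x\<in>cfgs V d. \<Sum>z\<in>cfgs V d. cmod (T x z) * (2 * card V + 1))" .
qed

text \<open>Test \<open>W1\<close> on \<open>H / L\<close> and on \<open>- H / L\<close>. Taking
  \<open>L\<close> as a positive upper bound, not \<open>lip\<close> itself, covers observables with
  \<open>lip\<close> equal to 0.\<close>

lemma Re_tr_le_lip_mult_W1:
  assumes fin: "finite V" and ne: "cfgs V d \<noteq> {}" and H: "self_adjoint V d H" and tr: "tr V d \<rho> = tr V d \<omega>"
    and L: "0 < L" "lip V d H \<le> L"
  shows "\<bar>Re (tr V d (op_mult V d (op_diff \<rho> \<omega>) H))\<bar> \<le> L * W1 V d \<rho> \<omega>"
proof -
  have *: "a * Re (tr V d (op_mult V d (op_diff \<rho> \<omega>) H)) \<le> W1 V d \<rho> \<omega>" if a: "\<bar>a\<bar> = 1 / L" for a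
  proof -
    have "a \<noteq> 0" using a L by auto
    then have "lip V d (op_scale (complex_of_real a) H) \<le> \<bar>a\<bar> * lip V d H" by (rule lip_scale_le[OF fin ne])
    also have "\<dots> \<le> 1" using a L by simp
    finally have l: "lip V d (op_scale (complex_of_real a) H) \<le> 1" .
    have "self_adjoint V d (op_scale (complex_of_real a) H)"
      using H by (auto simp: self_adjoint_def is_op_def op_adj_def op_scale_def fun_eq_iff)
    then have "Re (tr V d (op_mult V d (op_diff \<rho> \<omega>) (op_scale (complex_of_real a) H))) \<le> W1 V d \<rho> \<omega>"
      unfolding W1_def using l tr by (intro cSup_upper bdd_above_W1[OF fin]) (auto simp: tr_op_diff)
    then show ?thesis by (simp add: op_mult_scale_right tr_op_scale)
  qed
  show ?thesis using *[of "1 / L"] *[of "- 1 / L"] L by (auto simp: field_simps abs_le_iff)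
qed

subsection \<open>Measurement statistics\<close>

lemma spectrum_diag:
  assumes fin: "finite V" and u: "onb V d u"
  shows "spectrum_sa V d (diag_op V d u a) = a ` cfgs V d"
proof
  show "a ` cfgs V d \<subseteq> spectrum_sa V d (diag_op V d u a)"
  proof
    fix t assume "t \<in> a ` cfgs V d"
    then obtain k where k: "k \<in> cfgs V d" "t = a k" by blast
    have "vinner V d (u k) (u k) = 1" using u k by (simp add: onb_def)
    then have "u k \<noteq> (\<lambda>_. 0)" by (auto simp: vinner_def)
    then show "t \<in> spectrum_sa V d (diag_op V d u a)"
      using u k op_apply_diag_onb[OF fin u k(1), of a] by (auto simp: spectrum_sa_def onb_def)
  qed
  show "spectrum_sa V d (diag_op V d u a) \<subseteq> a ` cfgs V d"
  proof
    fix t assume "t \<in> spectrum_sa V d (diag_op V d u a)"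
    then obtain v where v: "is_vec V d v" "v \<noteq> (\<lambda>_. 0)"
      "op_apply V d (diag_op V d u a) v = (\<lambda>x. complex_of_real t * v x)"
      by (auto simp: spectrum_sa_def)
    have "vinner V d v v \<noteq> 0" using vinner_self_eq_0[OF fin v(1)] v(2) by blast
    then have "(\<Sum>k\<in>cfgs V d. vinner V d v (u k) * vinner V d (u k) v) \<noteq> 0"
      by (simp add: parseval[OF fin u v(1)])
    then obtain k where k: "k \<in> cfgs V d" "vinner V d (u k) v \<noteq> 0"
      by (metis (no_types, lifting) mult_eq_0_iff sum.neutral)
    have "complex_of_real t * vinner V d (u k) v = complex_of_real (a k) * vinner V d (u k) v"
      using brk_diag_onb_left[OF fin u k(1) v(1), of a]
      unfolding brk_def v(3) vinner_scale_right .
    then have "a k = t" using k(2) by simp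
    then show "t \<in> a ` cfgs V d" using k(1) by blast
  qed
qed

text \<open>Regrouping the sum over distinct eigenvalues as a sum over basis vectors absorbs
  multiplicities; the outcome law becomes a classical distribution on configurations.\<close>

lemma prob_abs_ge_diag:
  assumes fin: "finite V" and u: "onb V d u"
  shows "prob_abs_ge V d \<omega> (diag_op V d u a) r =
    (\<Sum>k\<in>{k\<in>cfgs V d. r \<le> \<bar>a k\<bar>}. Re (brk V d (u k) \<omega> (u k)))"
proof -
  let ?q = "\<lambda>k. Re (brk V d (u k) \<omega> (u k))"
  have finI: "finite (cfgs V d)" by (rule finite_cfgs[OF fin])
  have "Re (tr V d (op_mult V d \<omega> (spec_proj V d (diag_op V d u a) t))) = (\<Sum>k\<in>cfgs V d. if a k = t then ?q k else 0)" for t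
    by (simp add: spec_proj_def fcalc_diag[OF fin u] tr_mult_diag if_distrib[of complex_of_real] cong: if_cong)
      (intro sum.cong refl, simp)
  then have "prob_abs_ge V d \<omega> (diag_op V d u a) r =
      (\<Sum>t\<in>{t \<in> a ` cfgs V d. r \<le> \<bar>t\<bar>}. \<Sum>k\<in>cfgs V d. if a k = t then ?q k else 0)"
    by (simp add: prob_abs_ge_def spectrum_diag[OF fin u])
  also have "\<dots> = (\<Sum>k\<in>cfgs V d. \<Sum>t\<in>{t \<in> a ` cfgs V d. r \<le> \<bar>t\<bar>}. if t = a k then ?q k else 0)"
    by (subst sum.swap) (intro sum.cong refl, auto)
  also have "\<dots> = (\<Sum>k\<in>cfgs V d. if r \<le> \<bar>a k\<bar> then ?q k else 0)"
    using finI by (intro sum.cong refl) auto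
  also have "\<dots> = (\<Sum>k\<in>{k\<in>cfgs V d. r \<le> \<bar>a k\<bar>}. ?q k)"
    using finI by (intro sum.mono_neutral_cong_right) auto
  finally show ?thesis .
qed

lemma chernoff_two_sided:
  fixes q x :: "'i \<Rightarrow> real"
  assumes fin: "finite I" and q: "\<And>k. k \<in> I \<Longrightarrow> 0 \<le> q k" and K: "K > 0" and r: "r \<ge> 0"
    and mgf: "\<And>s. (\<Sum>k\<in>I. q k * exp (s * x k)) \<le> exp (s * m + s\<^sup>2 * K / 4)"
  shows "(\<Sum>k\<in>{k\<in>I. r \<le> \<bar>x k - m\<bar>}. q k) \<le> 2 * exp (- (r\<^sup>2 / K))"
proof -
  have tail: "(\<Sum>k\<in>{k\<in>I. r \<le> \<sigma> * (x k - m)}. q k) \<le> exp (- (r\<^sup>2 / K))" if \<sigma>: "\<sigma> = 1 \<or> \<sigma> = -1" for \<sigma> :: real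
  proof -
    \<comment> \<open>\<open>2 * r / K\<close> minimises \<open>s\<^sup>2 * K / 4 - s * r\<close>,
      with minimum \<open>- r\<^sup>2 / K\<close>; \<open>\<sigma>\<close> selects the upper or
      lower tail.\<close>
    define s where "s = 2 * r / K * \<sigma>"
    have ss: "s\<^sup>2 * K / 4 = r\<^sup>2 / K" "s * \<sigma> = 2 * r / K"
      using \<sigma> K by (auto simp: s_def power2_eq_square)
    have "(\<Sum>k\<in>{k\<in>I. r \<le> \<sigma> * (x k - m)}. q k) \<le> (\<Sum>k\<in>{k\<in>I. r \<le> \<sigma> * (x k - m)}. q k * exp (s * (x k - m) - 2 * r / K * r))"
    proof (rule sum_mono)
      fix k assume k: "k \<in> {k\<in>I. r \<le> \<sigma> * (x k - m)}"
      have "2 * r / K * r \<le> 2 * r / K * (\<sigma> * (x k - m))"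
        using k K r by (intro mult_left_mono) auto
      then have "1 \<le> exp (s * (x k - m) - 2 * r / K * r)" by (simp add: s_def mult_ac)
      then show "q k \<le> q k * exp (s * (x k - m) - 2 * r / K * r)"
        using q[of k] k mult_left_mono[of 1 _ "q k"] by simp
    qed
    also have "\<dots> \<le> (\<Sum>k\<in>I. q k * exp (s * (x k - m) - 2 * r / K * r))"
      using fin q by (intro sum_mono2) auto
    also have "\<dots> = (\<Sum>k\<in>I. q k * exp (s * x k)) * exp (- (s * m) - 2 * r / K * r)"
      unfolding sum_distrib_right
      by (intro sum.cong refl) (simp add: mult.assoc exp_add[symmetric] algebra_simps)
    also have "\<dots> \<le> exp (s * m + s\<^sup>2 * K / 4) * exp (- (s * m) - 2 * r / K * r)"
      by (intro mult_right_mono mgf) simp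
    also have "\<dots> = exp (- (r\<^sup>2 / K))"
      unfolding exp_add[symmetric] ss(1) by (simp add: power2_eq_square)
    finally show ?thesis .
  qed
  have "(\<Sum>k\<in>{k\<in>I. r \<le> \<bar>x k - m\<bar>}. q k) \<le> (\<Sum>k\<in>{k\<in>I. r \<le> 1 * (x k - m)} \<union> {k\<in>I. r \<le> -1 * (x k - m)}. q k)"
    using fin q by (intro sum_mono2) auto
  also have "\<dots> \<le> (\<Sum>k\<in>{k\<in>I. r \<le> 1 * (x k - m)}. q k) + (\<Sum>k\<in>{k\<in>I. r \<le> -1 * (x k - m)}. q k)"
    using fin q sum.union_inter[of "{k\<in>I. r \<le> 1 * (x k - m)}" "{k\<in>I. r \<le> -1 * (x k - m)}" q]
      sum_nonneg[of "{k\<in>I. r \<le> 1 * (x k - m)} \<inter> {k\<in>I. r \<le> -1 * (x k - m)}" q] by simp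
  also have "\<dots> \<le> 2 * exp (- (r\<^sup>2 / K))"
    using tail[of 1] tail[of "-1"] by linarith
  finally show ?thesis .
qed

section \<open>Traces, states and relative entropy in eigenbases\<close>

lemma tr_diag:
  assumes fin: "finite V" and u: "onb V d u"
  shows "tr V d (diag_op V d u f) = (\<Sum>k\<in>cfgs V d. f k)"
proof -
  have "tr V d (diag_op V d u f) = (\<Sum>k\<in>cfgs V d. f k * brk V d (u k) (op_id V d) (u k))"
    using tr_mult_diag[of V d "op_id V d" u f] by (simp add: is_op_mult_id[OF fin is_op_diag[OF u]])
  also have "\<dots> = (\<Sum>k\<in>cfgs V d. f k)"
    unfolding of_real_sum using u by (intro sum.cong refl) (simp add: brk_id[OF fin] onb_def)
  finally show ?thesis .
qed

lemma cmod_vinner_commute: "cmod (vinner V d u v) = cmod (vinner V d v u)"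
  by (metis complex_mod_cnj vinner_cnj)

lemma sum_cmod_brk_onb:
  assumes fin: "finite V" and u: "onb V d u" and R: "self_adjoint V d R"
  shows "(\<Sum>i\<in>cfgs V d. (cmod (brk V d (u i) R x))\<^sup>2) = Re (brk V d x (op_mult V d R R) x)"
    and "(\<Sum>i\<in>cfgs V d. (cmod (brk V d x R (u i)))\<^sup>2) = Re (brk V d x (op_mult V d R R) x)"
proof -
  have R': "is_op V d R" "op_adj R = R" using R by (auto simp: self_adjoint_def)
  have adj: "brk V d x R (u i) = cnj (brk V d (u i) R x)" for i
    using cnj_brk[of V d "u i" R x] R' by simp
  have "brk V d x (op_mult V d R R) x = (\<Sum>i\<in>cfgs V d. complex_of_real ((cmod (brk V d (u i) R x))\<^sup>2))"
    unfolding brk_mult_onb[OF fin u R'(1)]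
    by (intro sum.cong refl, subst complex_norm_square) (simp add: adj mult.commute)
  then show "(\<Sum>i\<in>cfgs V d. (cmod (brk V d (u i) R x))\<^sup>2) = Re (brk V d x (op_mult V d R R) x)"
    by simp
  then show "(\<Sum>i\<in>cfgs V d. (cmod (brk V d x R (u i)))\<^sup>2) = Re (brk V d x (op_mult V d R R) x)"
    by (simp add: adj)
qed

lemma Re_brk_diag:
  "Re (brk V d x (diag_op V d w b) x) = (\<Sum>j\<in>cfgs V d. b j * (cmod (vinner V d (w j) x))\<^sup>2)"
proof -
  have "brk V d x (diag_op V d w b) x = (\<Sum>j\<in>cfgs V d. complex_of_real (b j * (cmod (vinner V d (w j) x))\<^sup>2))"
    unfolding brk_diag of_real_mult complex_norm_square
    by (intro sum.cong refl) (simp add: vinner_cnj mult_ac)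
  then show ?thesis by simp
qed

lemma Re_brk_diag_pos:
  assumes fin: "finite V" and w: "onb V d w" and b: "\<And>j. j \<in> cfgs V d \<Longrightarrow> b j > 0"
    and x: "is_vec V d x" "vinner V d x x = 1"
  shows "0 < Re (brk V d x (diag_op V d w b) x)"
proof -
  have finI: "finite (cfgs V d)" by (rule finite_cfgs[OF fin])
  have "(\<Sum>j\<in>cfgs V d. (cmod (vinner V d (w j) x))\<^sup>2) = 1"
    using parseval_norm[OF fin w x(1)] x(2) by simp
  then obtain j where j: "j \<in> cfgs V d" "(cmod (vinner V d (w j) x))\<^sup>2 \<noteq> 0"
    by (metis (no_types, lifting) sum.neutral zero_neq_one)
  show ?thesis unfolding Re_brk_diag
    using b j by (intro sum_pos2[OF finI j(1)]) (auto simp: less_imp_le)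
qed

lemma state_eigenvalues:
  assumes fin: "finite V" and w: "onb V d w" and st: "is_state V d (diag_op V d w b)"
  shows "j \<in> cfgs V d \<Longrightarrow> 0 \<le> b j" "(\<Sum>j\<in>cfgs V d. b j) = 1"
proof -
  show "0 \<le> b j" if j: "j \<in> cfgs V d"
  proof -
    have "0 \<le> Re (brk V d (w j) (diag_op V d w b) (w j))"
      using st w j by (simp add: is_state_def psd_def brk_def onb_def)
    then show ?thesis using w j by (simp add: brk_diag_onb_right[OF fin w j] onb_def)
  qed
  have "complex_of_real (\<Sum>j\<in>cfgs V d. b j) = 1"
    using st tr_diag[OF fin w, of b] by (simp add: is_state_def)
  then show "(\<Sum>j\<in>cfgs V d. b j) = 1" by (metis of_real_eq_1_iff)
qed

lemma full_rank_eigenvalue_nonzero: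
  assumes fin: "finite V" and w: "onb V d w" and fr: "full_rank V d (diag_op V d w b)" and j: "j \<in> cfgs V d"
  shows "b j \<noteq> 0"
proof
  assume 0: "b j = 0"
  obtain B where B: "op_mult V d (diag_op V d w b) B = op_id V d"
    using fr by (auto simp: full_rank_def)
  have "vinner V d (w j) (w j) = brk V d (w j) (op_mult V d (diag_op V d w b) B) (w j)"
    using w j by (simp add: B brk_id[OF fin] onb_def)
  also have "\<dots> = 0" by (simp add: brk_diag_left[OF fin w j] 0)
  finally show False using w j by (simp add: onb_def)
qed

text \<open>The squared overlaps sum to 1 over \<open>j\<close>. Inserting this sum into the
  \<open>\<rho> ln \<rho>\<close> term puts both terms into one double sum, the classical relative
  entropy of the Nussbaum-Szkola distributions.\<close>

lemma rel_ent_diag: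
  assumes fin: "finite V" and v: "onb V d v" and w: "onb V d w"
  shows "rel_ent V d (diag_op V d v a) (diag_op V d w b) =
    (\<Sum>i\<in>cfgs V d. \<Sum>j\<in>cfgs V d. (cmod (vinner V d (v i) (w j)))\<^sup>2 * (a i * (ln (a i) - ln (b j))))"
proof -
  let ?c = "\<lambda>i j. (cmod (vinner V d (v i) (w j)))\<^sup>2"
  have c1: "(\<Sum>j\<in>cfgs V d. ?c i j) = 1" if i: "i \<in> cfgs V d" for i
  proof -
    have "(\<Sum>j\<in>cfgs V d. ?c i j) = (\<Sum>j\<in>cfgs V d. (cmod (vinner V d (w j) (v i)))\<^sup>2)"
      by (intro sum.cong refl) (subst cmod_vinner_commute, rule refl)
    then show ?thesis using parseval_norm[OF fin w, of "v i"] v i by (simp add: onb_def)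
  qed
  have "Re (tr V d (op_mult V d (diag_op V d v a) (diag_op V d v (\<lambda>i. ln (a i))))) = (\<Sum>i\<in>cfgs V d. a i * ln (a i))"
    by (simp add: diag_mult_diag[OF fin v] tr_diag[OF fin v] del: of_real_sum of_real_mult)
  also have "\<dots> = (\<Sum>i\<in>cfgs V d. (\<Sum>j\<in>cfgs V d. ?c i j) * (a i * ln (a i)))"
    by (intro sum.cong refl) (simp add: c1)
  finally have 1: "Re (tr V d (op_mult V d (diag_op V d v a) (diag_op V d v (\<lambda>i. ln (a i))))) =
      (\<Sum>i\<in>cfgs V d. \<Sum>j\<in>cfgs V d. ?c i j * (a i * ln (a i)))" by (simp add: sum_distrib_right)
  have "Re (tr V d (op_mult V d (diag_op V d v a) (diag_op V d w (\<lambda>j. ln (b j))))) =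
     (\<Sum>j\<in>cfgs V d. \<Sum>i\<in>cfgs V d. ?c i j * (a i * ln (b j)))"
    by (simp add: tr_mult_diag Re_brk_diag sum_distrib_left mult_ac)
  also have "\<dots> = (\<Sum>i\<in>cfgs V d. \<Sum>j\<in>cfgs V d. ?c i j * (a i * ln (b j)))"
    by (rule sum.swap)
  finally have 2: "Re (tr V d (op_mult V d (diag_op V d v a) (diag_op V d w (\<lambda>j. ln (b j))))) = \<dots>" .
  show ?thesis
    unfolding rel_ent_def fcalc_diag[OF fin v] fcalc_diag[OF fin w] op_mult_diff_right tr_op_diff
    by (simp add: 1 2 right_diff_distrib sum_subtractf)
qed

section \<open>The tilted state and its entropy\<close>

text \<open>The quadratic form at \<open>v\<close> is the sum of \<open>y k\<close> times the
  squared modulus of \<open>\<langle>v|R|e k\<rangle>\<close>, hence nonnegative; cyclicity reduces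
  the trace to the hypothesis \<open>tr\<close>.\<close>

lemma is_state_conjugated:
  assumes fin: "finite V" and e: "onb V d e" and R: "self_adjoint V d R"
    and y: "\<And>k. k \<in> cfgs V d \<Longrightarrow> 0 \<le> y k"
    and tr: "tr V d (op_mult V d (op_mult V d R R) (diag_op V d e y)) = 1"
  shows "is_state V d (op_mult V d R (op_mult V d (diag_op V d e y) R))"
proof -
  have R': "is_op V d R" "op_adj R = R" using R by (auto simp: self_adjoint_def)
  have "0 \<le> Re (brk V d v (op_mult V d R (op_mult V d (diag_op V d e y) R)) v)" for v
  proof -
    have "brk V d v (op_mult V d R (op_mult V d (diag_op V d e y) R)) v =
        (\<Sum>k\<in>cfgs V d. complex_of_real (y k * (cmod (brk V d v R (e k)))\<^sup>2))"
      unfolding brk_mult_diag_mult of_real_mult complex_norm_square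
      by (simp add: cnj_brk R'(2) mult.assoc)
    then show ?thesis using y by (simp add: sum_nonneg)
  qed
  moreover have "tr V d (op_mult V d R (op_mult V d (diag_op V d e y) R)) = 1"
    unfolding tr_mult_commute[of V d R] op_mult_assoc
    unfolding tr_mult_commute[of V d "diag_op V d e y"] by (rule tr)
  moreover have "self_adjoint V d (op_mult V d R (op_mult V d (diag_op V d e y) R))"
    using R' e unfolding self_adjoint_def op_adj_mult op_adj_diag op_mult_assoc
    by (auto intro!: is_op_mult is_op_diag)
  ultimately show ?thesis by (simp add: is_state_def psd_def brk_def)
qed

text \<open>Applies \<open>relative_entropy_le_classical\<close> to the vectors
  \<open>s\<^sub>k = R (e k)\<close>, whose squared norms are \<open>q k\<close>. The right-hand
  side is the relative entropy of the distribution \<open>q k * y k\<close> with respect to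
  \<open>q\<close>. The state gets a fresh eigenbasis \<open>v\<close>, since it is in general
  diagonal neither in \<open>e\<close> nor in \<open>w\<close>.\<close>

lemma rel_ent_conjugated_le:
  assumes fin: "finite V" and w: "onb V d w" and e: "onb V d e"
    and b: "\<And>j. j \<in> cfgs V d \<Longrightarrow> b j > 0" "(\<Sum>j\<in>cfgs V d. b j) = 1"
    and y: "\<And>k. k \<in> cfgs V d \<Longrightarrow> y k > 0"
    and R: "R = diag_op V d w (\<lambda>j. sqrt (b j))"
    and q: "q = (\<lambda>k. Re (brk V d (e k) (diag_op V d w b) (e k)))"
    and qy: "(\<Sum>k\<in>cfgs V d. q k) = 1" "(\<Sum>k\<in>cfgs V d. q k * y k) = 1"
    and st: "is_state V d (op_mult V d R (op_mult V d (diag_op V d e y) R))"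
  shows "rel_ent V d (op_mult V d R (op_mult V d (diag_op V d e y) R)) (diag_op V d w b) \<le>
    (\<Sum>k\<in>cfgs V d. q k * (y k * ln (y k)))"
proof -
  let ?I = "cfgs V d"
  have finI: "finite ?I" by (rule finite_cfgs[OF fin])
  define \<rho> where "\<rho> = op_mult V d R (op_mult V d (diag_op V d e y) R)"
  have st\<rho>: "is_state V d \<rho>" using st by (simp add: \<rho>_def)
  have "self_adjoint V d \<rho>" using st\<rho> by (simp add: is_state_def psd_def)
  then obtain v a where v: "onb V d v" and \<rho>: "\<rho> = diag_op V d v a"
    by (rule spectral_theorem[OF fin])
  have RR: "op_mult V d R R = diag_op V d w b"
  proof -
    have "diag_op V d w (\<lambda>j. sqrt (b j) * sqrt (b j)) = diag_op V d w b"
      unfolding diag_op_def using b(1) by (intro ext sum.cong refl) (simp add: less_imp_le)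
    then show ?thesis by (simp add: R diag_mult_diag[OF fin w])
  qed
  have Rsa: "self_adjoint V d R" unfolding R by (rule self_adjoint_diag[OF w])
  then have R': "is_op V d R" "op_adj R = R" by (auto simp: self_adjoint_def)
  have adj: "cnj (brk V d s R t) = brk V d t R s" for s t
    using R' by (simp add: cnj_brk)
  have vv: "is_vec V d (v i)" "vinner V d (v i) (v j) = (if i = j then 1 else 0)" if "i \<in> ?I" "j \<in> ?I" for i j
    using v that by (auto simp: onb_def)
  have ww: "is_vec V d (w i)" "vinner V d (w i) (w j) = (if i = j then 1 else 0)" if "i \<in> ?I" "j \<in> ?I" for i j
    using w that by (auto simp: onb_def)
  have \<alpha>: "(\<Sum>k\<in>?I. complex_of_real (y k) * brk V d (v i) R (e k) * cnj (brk V d (v j) R (e k))) =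
      (if i = j then complex_of_real (a i) else 0)" if "i \<in> ?I" "j \<in> ?I" for i j
  proof -
    have "(\<Sum>k\<in>?I. complex_of_real (y k) * brk V d (v i) R (e k) * cnj (brk V d (v j) R (e k))) = brk V d (v i) \<rho> (v j)"
      by (simp add: \<rho>_def brk_mult_diag_mult adj)
    then show ?thesis using that by (simp add: \<rho> brk_diag_onb_right[OF fin v] vv)
  qed
  have q1: "(\<Sum>i\<in>?I. (cmod (brk V d (v i) R (e k)))\<^sup>2) = q k" for k
    by (simp add: sum_cmod_brk_onb[OF fin v Rsa] RR q)
  have q2: "(\<Sum>j\<in>?I. (cmod (brk V d (e k) R (w j)))\<^sup>2) = q k" for k
    by (simp add: sum_cmod_brk_onb[OF fin w Rsa] RR q)
  \<comment> \<open>\<open>a i\<close> is the sum of \<open>y k\<close> times the squared modulus of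
    \<open>\<langle>v i|R|e k\<rangle>\<close>. Not all of these vanish, because the unweighted sum
    is the expectation of the positive definite \<open>\<omega>\<close> in
    \<open>v i\<close>.\<close>
  have a: "a i > 0" if i: "i \<in> ?I" for i
  proof -
    have "(\<Sum>k\<in>?I. (cmod (brk V d (v i) R (e k)))\<^sup>2) > 0"
      unfolding sum_cmod_brk_onb(2)[OF fin e Rsa] RR
      by (rule Re_brk_diag_pos[OF fin w b(1)]) (use vv i in auto)
    then obtain k where k: "k \<in> ?I" "cmod (brk V d (v i) R (e k)) \<noteq> 0"
      by (metis (no_types, lifting) less_irrefl sum.neutral zero_power2)
    have "complex_of_real (a i) = (\<Sum>k\<in>?I. complex_of_real (y k * (cmod (brk V d (v i) R (e k)))\<^sup>2))"
      using \<alpha>[OF i i] unfolding of_real_mult complex_norm_square by (simp add: mult.assoc)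
    then have "a i = (\<Sum>k\<in>?I. y k * (cmod (brk V d (v i) R (e k)))\<^sup>2)"
      unfolding of_real_sum[symmetric] of_real_eq_iff .
    also have "\<dots> > 0" using k y by (intro sum_pos2[OF finI k(1)]) (auto simp: less_imp_le)
    finally show ?thesis .
  qed
  have "(\<Sum>i\<in>?I. \<Sum>j\<in>?I. (cmod (vinner V d (v i) (w j)))\<^sup>2 * (a i * (ln (a i) - ln (b j)))) \<le>
      (\<Sum>k\<in>?I. q k * (y k * ln (y k)))"
  proof (rule relative_entropy_le_classical[OF finI a b(1) y \<alpha> _ _ q1 q2])
    show "(\<Sum>k\<in>?I. brk V d (e k) R (w i) * cnj (brk V d (e k) R (w j))) = (if i = j then complex_of_real (b i) else 0)"
      if "i \<in> ?I" "j \<in> ?I" for i j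
    proof -
      have "(\<Sum>k\<in>?I. brk V d (e k) R (w i) * cnj (brk V d (e k) R (w j))) = brk V d (w j) (op_mult V d R R) (w i)"
        unfolding brk_mult_onb[OF fin e R'(1)] by (simp add: adj mult.commute)
      then show ?thesis using that by (simp add: RR brk_diag_onb_right[OF fin w] ww)
    qed
    show "(\<Sum>k\<in>?I. brk V d (v i) R (e k) * brk V d (e k) R (w j)) = b j * vinner V d (v i) (w j)"
      if "i \<in> ?I" "j \<in> ?I" for i j
      unfolding brk_mult_onb[OF fin e R'(1), symmetric] RR by (rule brk_diag_onb_right[OF fin w that(2)])
    show "(\<Sum>j\<in>?I. (cmod (vinner V d (v i) (w j)))\<^sup>2) = 1" if "i \<in> ?I" for i
    proof -
      have "(\<Sum>j\<in>?I. (cmod (vinner V d (v i) (w j)))\<^sup>2) = (\<Sum>j\<in>?I. (cmod (vinner V d (w j) (v i)))\<^sup>2)"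
        by (intro sum.cong refl) (subst cmod_vinner_commute, rule refl)
      then show ?thesis using parseval_norm[OF fin w, of "v i"] vv that by simp
    qed
    show "(\<Sum>i\<in>?I. (cmod (vinner V d (v i) (w j)))\<^sup>2) = 1" if "j \<in> ?I" for j
      using parseval_norm[OF fin v, of "w j"] ww that by simp
    show "(\<Sum>i\<in>?I. a i) = 1" using state_eigenvalues(2)[OF fin v] st\<rho> by (simp add: \<rho>)
  qed (use b qy in auto)
  then show ?thesis using rel_ent_diag[OF fin v w, of a b] by (simp add: \<rho>[symmetric] \<rho>_def[symmetric])
qed

text \<open>Commutation makes the matrix elements of \<open>A\<close> vanish between eigenvectors
  with different \<open>b\<close>; on the remaining ones \<open>f\<close> takes equal
  values.\<close>

lemma diag_commute:
  assumes fin: "finite V" and w: "onb V d w" and A: "is_op V d A"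
    and comm: "op_mult V d A (diag_op V d w b) = op_mult V d (diag_op V d w b) A"
  shows "op_mult V d A (diag_op V d w (\<lambda>j. f (b j))) = op_mult V d (diag_op V d w (\<lambda>j. f (b j))) A"
proof (rule op_eqI_onb[OF fin w w])
  fix k l assume k: "k \<in> cfgs V d" and l: "l \<in> cfgs V d"
  have "b l * brk V d (w k) A (w l) = b k * brk V d (w k) A (w l)"
    using brk_diag_right[OF fin w l, of "w k" A b] brk_diag_left[OF fin w k, of b A "w l"] comm by metis
  then have "b l = b k \<or> brk V d (w k) A (w l) = 0" by (metis mult_cancel_right of_real_eq_iff)
  then show "brk V d (w k) (op_mult V d A (diag_op V d w (\<lambda>j. f (b j)))) (w l) =
      brk V d (w k) (op_mult V d (diag_op V d w (\<lambda>j. f (b j))) A) (w l)"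
    by (auto simp: brk_diag_right[OF fin w l] brk_diag_left[OF fin w k])
qed (use A w is_op_mult is_op_diag in blast)+

subsection \<open>Concentration\<close>

lemma self_adjoint_op_re: "is_op V d X \<Longrightarrow> self_adjoint V d (op_re X)"
  by (auto simp: self_adjoint_def op_re_def op_scale_def op_add_def op_adj_def is_op_def fun_eq_iff add.commute)

text \<open>For self-adjoint \<open>A\<close> the traces against \<open>X\<close> and its adjoint
  are complex conjugates, so averaging them leaves the real part. This replaces the non-self-adjoint
  \<open>X\<close> by an observable that may be used in \<open>W1\<close>.\<close>

lemma Re_tr_mult_op_re:
  assumes "op_adj A = A"
  shows "Re (tr V d (op_mult V d A (op_re X))) = Re (tr V d (op_mult V d A X))"
proof -
  have "tr V d (op_mult V d A (op_adj X)) = cnj (tr V d (op_mult V d X A))"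
    unfolding tr_op_adj[symmetric] op_adj_mult assms ..
  then show ?thesis
    by (simp add: op_re_def op_mult_scale_right op_mult_add_right tr_op_scale tr_op_add tr_mult_commute[of V d X])
qed

text \<open>Bobkov-Goetze: the entropy \<open>D\<close> of the tilt is at most
  \<open>s * m - ln F\<close>, while the transport inequality bounds \<open>s * (m - E)\<close> by a
  Gaussian term plus \<open>D\<close>. Adding the two cancels both \<open>m\<close> and
  \<open>D\<close>.\<close>

lemma laplace_bound:
  fixes V :: "'v set" and e :: "('v \<Rightarrow> nat) \<Rightarrow> 'v qvec"
  assumes fin: "finite V" and w: "onb V d w" and e: "onb V d e"
    and \<omega>: "\<omega> = diag_op V d w b" and Ob: "Ob = diag_op V d e x"
    and st: "is_state V d \<omega>" and b: "\<And>j. j \<in> cfgs V d \<Longrightarrow> b j > 0"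
    and c: "0 < c" and TC: "TC V d c \<omega>"
    and X: "X = op_mult V d (op_mult V d (diag_op V d w (\<lambda>j. inverse (sqrt (b j)))) Ob) (diag_op V d w (\<lambda>j. sqrt (b j)))"
    and L: "0 < L" "lip V d (op_re X) \<le> L"
    and q: "q = (\<lambda>k. Re (brk V d (e k) \<omega> (e k)))"
  shows "(\<Sum>k\<in>cfgs V d. q k * exp (s * x k)) \<le> exp (s * (\<Sum>k\<in>cfgs V d. q k * x k) + s\<^sup>2 * (c * L\<^sup>2) / 4)"
proof -
  let ?I = "cfgs V d"
  define E where "E = (\<Sum>k\<in>?I. q k * x k)"
  have finI: "finite ?I" by (rule finite_cfgs[OF fin])
  have \<omega>sa: "self_adjoint V d \<omega>" using st by (simp add: is_state_def psd_def)
  have \<omega>op: "is_op V d \<omega>" "op_adj \<omega> = \<omega>" using \<omega>sa by (auto simp: self_adjoint_def)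
  have tr\<omega>: "tr V d \<omega> = 1" using st by (simp add: is_state_def)
  have ne: "?I \<noteq> {}" using tr\<omega> by (auto simp: tr_def)
  have qc: "brk V d (e k) \<omega> (e k) = complex_of_real (q k)" for k
    using cnj_brk[of V d "e k" \<omega> "e k"] \<omega>op by (simp add: q complex_eq_iff)
  have q0: "0 \<le> q k" if "k \<in> ?I" for k
    using st e that by (simp add: q is_state_def psd_def brk_def onb_def)
  have tr_f: "tr V d (op_mult V d \<omega> (diag_op V d e f)) = complex_of_real (\<Sum>k\<in>?I. q k * f k)" for f
    by (simp add: tr_mult_diag qc mult.commute)
  have q1: "(\<Sum>k\<in>?I. q k) = 1"
  proof -
    have "tr V d \<omega> = complex_of_real (\<Sum>k\<in>?I. q k)"
      using tr_f[of "\<lambda>_. 1"] by (simp add: onb_complete[OF fin e] is_op_mult_id[OF fin \<omega>op(1)])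
    then show ?thesis using tr\<omega> by (metis of_real_eq_1_iff)
  qed
  define F where "F = (\<Sum>k\<in>?I. q k * exp (s * x k))"
  have F: "F > 0"
  proof -
    obtain k where k: "k \<in> ?I" "q k \<noteq> 0" using q1 by (metis (no_types, lifting) sum.neutral zero_neq_one)
    then have "q k > 0" using q0[OF k(1)] by simp
    then show ?thesis unfolding F_def using q0 by (intro sum_pos2[OF finI k(1)]) auto
  qed
  \<comment> \<open>\<open>y\<close> is the density of the classical tilt with respect to
    \<open>q\<close>, and \<open>m\<close> below is the tilted mean.\<close>
  define y where "y k = exp (s * x k) / F" for k
  define m where "m = (\<Sum>k\<in>?I. q k * (y k * x k))"
  have y: "y k > 0" for k using F by (simp add: y_def)
  have qy: "(\<Sum>k\<in>?I. q k * y k) = 1"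
    unfolding y_def times_divide_eq_right sum_divide_distrib[symmetric] F_def[symmetric] using F by simp
  define R where "R = diag_op V d w (\<lambda>j. sqrt (b j))"
  define S where "S = diag_op V d w (\<lambda>j. inverse (sqrt (b j)))"
  define Y where "Y = diag_op V d e y"
  have RR: "op_mult V d R R = \<omega>"
    unfolding R_def \<omega> diag_mult_diag[OF fin w] using b
    by (auto simp: diag_op_def less_imp_le intro!: ext sum.cong)
  have RS: "op_mult V d R S = op_id V d"
    unfolding R_def S_def diag_mult_diag[OF fin w] onb_complete[OF fin w, symmetric]
    unfolding diag_op_def
  proof (intro ext sum.cong refl)
    fix u v j assume "j \<in> ?I"
    then have "sqrt (b j) * inverse (sqrt (b j)) = 1" using b[of j] by simp
    then show "complex_of_real (sqrt (b j) * inverse (sqrt (b j))) * w j u * cnj (w j v) = complex_of_real 1 * w j u * cnj (w j v)"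
      by (simp only:)
  qed
  have Obop: "is_op V d Ob" unfolding Ob by (rule is_op_diag[OF e])
  have Rsa: "self_adjoint V d R" unfolding R_def by (rule self_adjoint_diag[OF w])
  have Rop: "is_op V d R" using Rsa by (simp add: self_adjoint_def)
  have Xop: "is_op V d X" unfolding X by (intro is_op_mult is_op_diag w Obop)
  \<comment> \<open>The inverse root in \<open>X\<close> cancels here; traces of \<open>X\<close>
    against \<open>\<rho>\<close> and \<open>\<omega>\<close> thereby become classical sums in the
    eigenbasis of \<open>Ob\<close>.\<close>
  have RX: "op_mult V d R X = op_mult V d Ob R"
    unfolding X S_def[symmetric] R_def[symmetric] op_mult_assoc[symmetric] RS
    by (simp add: op_mult_assoc is_op_mult_id[OF fin] Obop is_op_mult Rop)
  have sandwich: "op_mult V d (op_mult V d R (op_mult V d A R)) X = op_mult V d R (op_mult V d A (op_mult V d Ob R))" for A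
    by (simp only: op_mult_assoc RX)
  define \<rho> where "\<rho> = op_mult V d R (op_mult V d Y R)"
  have st\<rho>: "is_state V d \<rho>" unfolding \<rho>_def Y_def
    by (rule is_state_conjugated[OF fin e Rsa]) (simp_all add: less_imp_le[OF y] RR tr_f qy del: of_real_sum of_real_mult)
  have \<rho>sa: "op_adj \<rho> = \<rho>" using st\<rho> by (simp add: is_state_def psd_def self_adjoint_def)
  have "Re (tr V d (op_mult V d \<rho> (op_re X))) = m"
  proof -
    have "tr V d (op_mult V d \<rho> X) = tr V d (op_mult V d (op_mult V d R R) (op_mult V d Y Ob))"
      unfolding \<rho>_def sandwich tr_mult_commute[of V d R] tr_mult_commute[of V d "op_mult V d R R"]
      by (simp only: op_mult_assoc)
    also have "\<dots> = complex_of_real m"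
      by (simp add: RR Y_def Ob diag_mult_diag[OF fin e] tr_f m_def del: of_real_sum of_real_mult)
    finally show ?thesis by (simp add: Re_tr_mult_op_re[OF \<rho>sa])
  qed
  moreover have "Re (tr V d (op_mult V d \<omega> (op_re X))) = E"
  proof -
    have "tr V d (op_mult V d \<omega> X) = tr V d (op_mult V d (op_mult V d R R) Ob)"
      unfolding RR[symmetric] op_mult_assoc RX tr_mult_commute[of V d R] ..
    also have "\<dots> = complex_of_real E"
      by (simp add: RR Ob tr_f E_def del: of_real_sum of_real_mult)
    finally show ?thesis by (simp add: Re_tr_mult_op_re[OF \<omega>op(2)])
  qed
  ultimately have mE: "Re (tr V d (op_mult V d (op_diff \<rho> \<omega>) (op_re X))) = m - E"
    by (simp add: op_mult_diff_left tr_op_diff)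
  define D where "D = rel_ent V d \<rho> \<omega>"
  have "\<bar>m - E\<bar> \<le> L * W1 V d \<rho> \<omega>"
    unfolding mE[symmetric] using st\<rho> st
    by (intro Re_tr_le_lip_mult_W1[OF fin ne self_adjoint_op_re[OF Xop] _ L]) (simp add: is_state_def)
  also have "\<dots> \<le> L * sqrt (c * D)"
    using TC st\<rho> L(1) unfolding TC_def D_def by (intro mult_left_mono) auto
  finally have dev: "\<bar>m - E\<bar> \<le> L * sqrt (c * D)" .
  \<comment> \<open>Nonnegativity of the relative entropy is read off from the transport inequality:
    the real \<open>sqrt\<close> of a negative number is negative.\<close>
  then have "0 \<le> L * sqrt (c * D)" by linarith
  then have D0: "0 \<le> D" using L(1) c by (simp add: zero_le_mult_iff)
  have ln_y: "ln (y k) = s * x k - ln F" for k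
    using F by (simp add: y_def ln_div)
  have "D \<le> (\<Sum>k\<in>?I. q k * (y k * ln (y k)))"
    unfolding D_def \<rho>_def Y_def \<omega>
    by (rule rel_ent_conjugated_le[OF fin w e b _ y R_def])
      (use q q1 qy st\<rho> state_eigenvalues(2)[OF fin w] st in \<open>auto simp: \<omega> \<rho>_def Y_def\<close>)
  also have "\<dots> = (\<Sum>k\<in>?I. s * (q k * (y k * x k)) - ln F * (q k * y k))"
    by (intro sum.cong refl) (simp add: ln_y algebra_simps)
  also have "\<dots> = s * m - ln F"
    by (simp add: sum_subtractf sum_distrib_left[symmetric] m_def qy)
  finally have Dle: "D \<le> s * m - ln F" .
  have "s * (m - E) \<le> \<bar>s\<bar> * (L * sqrt (c * D))"
    using dev by (metis abs_ge_self abs_ge_zero abs_mult mult_left_mono order_trans)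
  \<comment> \<open>Arithmetic-geometric mean inequality, weighted so that \<open>D\<close> has
    coefficient exactly 1 and cancels against \<open>Dle\<close>.\<close>
  also have "\<dots> \<le> s\<^sup>2 * (c * L\<^sup>2) / 4 + D"
  proof -
    have "0 \<le> (\<bar>s\<bar> * L * sqrt c / 2 - sqrt D)\<^sup>2" by simp
    also have "\<dots> = s\<^sup>2 * (c * L\<^sup>2) / 4 + D - \<bar>s\<bar> * (L * sqrt (c * D))"
      using c D0 by (simp add: power2_diff power_mult_distrib power_divide real_sqrt_mult)
    finally show ?thesis by simp
  qed
  finally have "ln F \<le> s * E + s\<^sup>2 * (c * L\<^sup>2) / 4"
    using Dle by (simp add: right_diff_distrib)
  then have "F \<le> exp (s * E + s\<^sup>2 * (c * L\<^sup>2) / 4)"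
    using F by (metis exp_le_cancel_iff exp_ln)
  then show ?thesis by (simp add: F_def E_def)
qed

lemma op_diff_diag_scalar:
  assumes "finite V" "onb V d e"
  shows "op_diff (diag_op V d e x) (op_scale (complex_of_real m) (op_id V d)) = diag_op V d e (\<lambda>k. x k - m)"
  unfolding onb_complete[OF assms, symmetric]
  by (simp add: op_diff_def op_scale_def diag_op_def sum_distrib_left left_diff_distrib sum_subtractf mult.assoc)

text \<open>\<open>L\<close> is any positive upper bound of the Lipschitz constant: this keeps the
  quotient meaningful and lets both claims follow by different choices of \<open>L\<close>.\<close>

lemma concentration:
  fixes V :: "'v set" and \<omega> Ob :: "'v qop"
  assumes fin: "finite V" and st: "is_state V d \<omega>" and fr: "full_rank V d \<omega>"
    and c: "0 < c" and TC: "TC V d c \<omega>" and Ob: "self_adjoint V d Ob" and r: "0 \<le> r"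
    and L: "0 < L"
      "lip V d (op_re (op_mult V d (op_mult V d (fcalc V d (\<lambda>t. inverse (sqrt t)) \<omega>) Ob) (fcalc V d sqrt \<omega>))) \<le> L"
  shows "prob_abs_ge V d \<omega> (op_diff Ob (op_scale (tr V d (op_mult V d \<omega> Ob)) (op_id V d))) r
    \<le> 2 * exp (- (r\<^sup>2 / (c * L\<^sup>2)))"
proof -
  have "self_adjoint V d \<omega>" using st by (simp add: is_state_def psd_def)
  then obtain w b where w: "onb V d w" and \<omega>: "\<omega> = diag_op V d w b" by (rule spectral_theorem[OF fin])
  obtain e x where e: "onb V d e" and x: "Ob = diag_op V d e x" by (rule spectral_theorem[OF fin Ob])
  have b: "b j > 0" if "j \<in> cfgs V d" for j
    using state_eigenvalues(1)[OF fin w _ that] full_rank_eigenvalue_nonzero[OF fin w _ that] st fr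
    by (fastforce simp: \<omega>)
  define q where "q = (\<lambda>k. Re (brk V d (e k) \<omega> (e k)))"
  define m where "m = (\<Sum>k\<in>cfgs V d. q k * x k)"
  have q0: "0 \<le> q k" if "k \<in> cfgs V d" for k
    using st e that by (simp add: q_def is_state_def psd_def brk_def onb_def)
  have "brk V d (e k) \<omega> (e k) = complex_of_real (q k)" for k
    using cnj_brk[of V d "e k" \<omega> "e k"] by (simp add: q_def complex_eq_iff \<omega> op_adj_diag)
  then have "tr V d (op_mult V d \<omega> Ob) = complex_of_real m"
    by (simp add: x tr_mult_diag m_def mult.commute)
  then have "prob_abs_ge V d \<omega> (op_diff Ob (op_scale (tr V d (op_mult V d \<omega> Ob)) (op_id V d))) r =
      (\<Sum>k\<in>{k\<in>cfgs V d. r \<le> \<bar>x k - m\<bar>}. q k)"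
    unfolding x by (simp add: op_diff_diag_scalar[OF fin e] prob_abs_ge_diag[OF fin e] q_def)
  also have "\<dots> \<le> 2 * exp (- (r\<^sup>2 / (c * L\<^sup>2)))"
  proof (rule chernoff_two_sided[OF finite_cfgs[OF fin] q0 _ r])
    show "0 < c * L\<^sup>2" using c L by simp
    show "(\<Sum>k\<in>cfgs V d. q k * exp (s * x k)) \<le> exp (s * m + s\<^sup>2 * (c * L\<^sup>2) / 4)" for s
      unfolding m_def
      by (rule laplace_bound[OF fin w e \<omega> x st b c TC refl L(1) _ q_def])
        (use L(2) in \<open>simp_all add: \<omega> fcalc_diag[OF fin w]\<close>)
  qed
  finally show ?thesis .
qed

text \<open>Settles the degenerate case of a zero denominator, where the claimed bound is 2.\<close>

lemma prob_abs_ge_le_1: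
  assumes fin: "finite V" and st: "is_state V d \<omega>" and Q: "self_adjoint V d Q"
  shows "prob_abs_ge V d \<omega> Q r \<le> 1"
proof -
  obtain e x where e: "onb V d e" and x: "Q = diag_op V d e x" by (rule spectral_theorem[OF fin Q])
  have "prob_abs_ge V d \<omega> Q r \<le> (\<Sum>k\<in>cfgs V d. Re (brk V d (e k) \<omega> (e k)))"
    unfolding x prob_abs_ge_diag[OF fin e] using finite_cfgs[OF fin] st e
    by (intro sum_mono2) (auto simp: is_state_def psd_def brk_def onb_def)
  also have "\<dots> = Re (tr V d (op_mult V d \<omega> (diag_op V d e (\<lambda>_. 1))))"
    by (simp add: tr_mult_diag)
  also have "\<dots> = 1"
    using st by (simp add: onb_complete[OF fin e] is_op_mult_id[OF fin] is_state_def psd_def self_adjoint_def)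
  finally show ?thesis .
qed

lemma conjugation_by_commuting_state:
  fixes V :: "'v set" and \<omega> Ob :: "'v qop"
  assumes fin: "finite V" and st: "is_state V d \<omega>" and fr: "full_rank V d \<omega>"
    and Ob: "self_adjoint V d Ob" and comm: "op_mult V d Ob \<omega> = op_mult V d \<omega> Ob"
  shows "op_mult V d (op_mult V d (fcalc V d (\<lambda>t. inverse (sqrt t)) \<omega>) Ob) (fcalc V d sqrt \<omega>) = Ob"
proof -
  have "self_adjoint V d \<omega>" using st by (simp add: is_state_def psd_def)
  then obtain w b where w: "onb V d w" and \<omega>: "\<omega> = diag_op V d w b" by (rule spectral_theorem[OF fin])
  have Obop: "is_op V d Ob" using Ob by (simp add: self_adjoint_def)
  have b: "b j > 0" if "j \<in> cfgs V d" for j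
    using state_eigenvalues(1)[OF fin w _ that] full_rank_eigenvalue_nonzero[OF fin w _ that] st fr
    by (fastforce simp: \<omega>)
  have one: "diag_op V d w (\<lambda>j. inverse (sqrt (b j)) * sqrt (b j)) = op_id V d"
    unfolding onb_complete[OF fin w, symmetric] diag_op_def
  proof (intro ext sum.cong refl)
    fix u v j assume "j \<in> cfgs V d"
    then have "inverse (sqrt (b j)) * sqrt (b j) = 1" using b[of j] by simp
    then show "complex_of_real (inverse (sqrt (b j)) * sqrt (b j)) * w j u * cnj (w j v) = complex_of_real 1 * w j u * cnj (w j v)"
      by (simp only:)
  qed
  have "op_mult V d Ob (diag_op V d w (\<lambda>j. sqrt (b j))) = op_mult V d (diag_op V d w (\<lambda>j. sqrt (b j))) Ob"
    by (rule diag_commute[OF fin w Obop, where f = sqrt and b = b]) (use comm in \<open>simp add: \<omega>\<close>)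
  then have "op_mult V d (diag_op V d w (\<lambda>j. inverse (sqrt (b j)))) (op_mult V d Ob (diag_op V d w (\<lambda>j. sqrt (b j)))) =
      op_mult V d (op_id V d) Ob"
    by (simp only: op_mult_assoc[symmetric] one[symmetric] diag_mult_diag[OF fin w])
  then show ?thesis
    by (simp only: \<omega> fcalc_diag[OF fin w] op_mult_assoc is_op_mult_id[OF fin Obop])
qed

lemma tr_mult_self_adjoint_real:
  assumes "op_adj A = A" "op_adj B = B"
  shows "cnj (tr V d (op_mult V d A B)) = tr V d (op_mult V d A B)"
  unfolding tr_op_adj[symmetric] op_adj_mult assms by (rule tr_mult_commute)

theorem mainTheorem16:
  fixes V :: "'v set" and d :: nat and \<omega> Ob :: "'v qop" and c r :: real
  assumes "finite V"
    and "is_state V d \<omega>" and "full_rank V d \<omega>"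
    and "0 < c" and "TC V d c \<omega>"
    and "self_adjoint V d Ob" and "0 \<le> r"
  shows "(prob_abs_ge V d \<omega> (op_diff Ob (op_scale (tr V d (op_mult V d \<omega> Ob)) (op_id V d))) r
           \<le> 2 * exp (- (r\<^sup>2 / (4 * c * max
               ((lip V d (op_re (op_mult V d (op_mult V d (fcalc V d (\<lambda>t. inverse (sqrt t)) \<omega>) Ob)
                                    (fcalc V d sqrt \<omega>))))\<^sup>2)
               ((lip V d (op_im (op_mult V d (op_mult V d (fcalc V d (\<lambda>t. inverse (sqrt t)) \<omega>) Ob)
                                    (fcalc V d sqrt \<omega>))))\<^sup>2)))))
         \<and> (op_mult V d Ob \<omega> = op_mult V d \<omega> Ob \<longrightarrow>
         prob_abs_ge V d \<omega> (op_diff Ob (op_scale (tr V d (op_mult V d \<omega> Ob)) (op_id V d))) r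
           \<le> 2 * exp (- (r\<^sup>2 / (c * (lip V d Ob)\<^sup>2))))"
proof -
  define X where "X = op_mult V d (op_mult V d (fcalc V d (\<lambda>t. inverse (sqrt t)) \<omega>) Ob) (fcalc V d sqrt \<omega>)"
  define Q where "Q = op_diff Ob (op_scale (tr V d (op_mult V d \<omega> Ob)) (op_id V d))"
  have adj: "op_adj \<omega> = \<omega>" "op_adj Ob = Ob"
    using assms by (auto simp: is_state_def psd_def self_adjoint_def)
  have "is_op V d Q"
    using assms(6) by (auto simp: Q_def self_adjoint_def is_op_def op_diff_def op_scale_def op_id_def)
  moreover have "op_adj Q = Q"
  proof (intro ext)
    fix y z
    have "cnj (Ob z y) = Ob y z" using adj(2) by (simp add: op_adj_def fun_eq_iff)
    then show "op_adj Q y z = Q y z"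
      using tr_mult_self_adjoint_real[OF adj, of V d] by (auto simp: Q_def op_adj_def op_diff_def op_scale_def op_id_def)
  qed
  ultimately have "self_adjoint V d Q" by (simp add: self_adjoint_def)
  then have P1: "prob_abs_ge V d \<omega> Q r \<le> 1"
    by (rule prob_abs_ge_le_1[OF assms(1,2)])
  have main: "prob_abs_ge V d \<omega> Q r \<le> 2 * exp (- (r\<^sup>2 / (c * M\<^sup>2)))" if "0 \<le> M" "lip V d (op_re X) \<le> M" for M
  proof (cases "M = 0")
    case True
    \<comment> \<open>\<open>r\<^sup>2 / 0 = 0\<close>, so the bound is the trivial one\<close>
    then show ?thesis using P1 by simp
  next
    case False
    then show ?thesis using concentration[OF assms, of M] that by (simp add: Q_def X_def)
  qed
  have "prob_abs_ge V d \<omega> Q r \<le> 2 * exp (- (r\<^sup>2 / (4 * c * max ((lip V d (op_re X))\<^sup>2) ((lip V d (op_im X))\<^sup>2))))"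
  proof -
    \<comment> \<open>The 4 of the first claim is the square of this 2.\<close>
    define M where "M = 2 * max (lip V d (op_re X)) (lip V d (op_im X))"
    have l: "0 \<le> lip V d (op_re X)" "0 \<le> lip V d (op_im X)"
      by (rule lip_nonneg[OF assms(1)])+
    have "prob_abs_ge V d \<omega> Q r \<le> 2 * exp (- (r\<^sup>2 / (c * M\<^sup>2)))"
      by (rule main) (use l in \<open>auto simp: M_def\<close>)
    moreover have "c * M\<^sup>2 = 4 * c * max ((lip V d (op_re X))\<^sup>2) ((lip V d (op_im X))\<^sup>2)"
      using l by (auto simp: M_def max_def power_mult_distrib dest: power_mono[where n = 2])
    ultimately show ?thesis by simp
  qed
  moreover have "prob_abs_ge V d \<omega> Q r \<le> 2 * exp (- (r\<^sup>2 / (c * (lip V d Ob)\<^sup>2)))"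
    if "op_mult V d Ob \<omega> = op_mult V d \<omega> Ob"
  proof (rule main[OF lip_nonneg[OF assms(1)]])
    have "X = Ob" unfolding X_def by (rule conjugation_by_commuting_state[OF assms(1-3,6) that])
    moreover have "op_re Ob = Ob"
      by (simp add: op_re_def op_scale_def op_add_def adj)
    ultimately show "lip V d (op_re X) \<le> lip V d Ob" by simp
  qed
  ultimately show ?thesis unfolding X_def Q_def by blast
qed

end
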